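(* Let $T$ be a commutative strong Frobenius monad on a symmetric monoidal dagger category $\mathcal{C}$. Then the Kleisli category $\mathcal{C}_T$ is a symmetric monoidal dagger category, with tensor $A\otimes_T B=A\otimes B$ on objects, $f\otimes_T g=\mathrm{dst}\circ(f\otimes g)$ on morphisms, coherence isomorphisms and symmetry the images of those of $\mathcal{C}$ under the canonical functor $\mathcal{C}\to\mathcal{C}_T$, and dagger sending $f\colon A\to T(B)$ to $T(f^\dagger)\circ\mu_B^\dagger\circ\eta_B$.
   Context: A dagger category has an identity-on-objects contravariant functor $f\mapsto f^\dagger$ with $f^{\dagger\dagger}=f$; $f$ is unitary if $f^\dagger=f^{-1}$. A symmetric monoidal dagger category is a symmetric monoidal category with a dagger such that $(f\otimes g)^\dagger=f^\dagger\otimes g^\dagger$ and associators, unitors and symmetries $\sigma$ are unitary. A Frobenius monad is a monad $(T,\mu,\eta)$ with $T(f^\dagger)=T(f)^\dagger$ and $T(\mu_A)\circ\mu^\dagger_{T(A)}=\mu_{T(A)}\circ T(\mu_A^\dagger)$. A strong monad has a natural transformation $\mathrm{st}_{A,B}\colon A\otimes T(B)\to T(A\otimes B)$ with $\mathrm{st}\circ\alpha=T(\alpha)\circ\mathrm{st}\circ(\mathrm{id}\otimes\mathrm{st})$, $T(\lambda)\circ\mathrm{st}=\lambda$, $\mathrm{st}\circ(\mathrm{id}\otimes\mu)=\mu\circ T(\mathrm{st})\circ\mathrm{st}$, $\mathrm{st}\circ(\mathrm{id}\otimes\eta)=\eta$. A strong Frobenius monad is a Frobenius monad that is a strong monad with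 each $\mathrm{st}$ unitary. Define $\mathrm{st}'_{A,B}=T(\sigma_{B,A})\circ\mathrm{st}_{B,A}\circ\sigma_{T(A),B}\colon T(A)\otimes B\to T(A\otimes B)$, $\mathrm{dst}_{A,B}=\mu_{A\otimes B}\circ T(\mathrm{st}'_{A,B})\circ\mathrm{st}_{T(A),B}$ and $\mathrm{dst}'_{A,B}=\mu_{A\otimes B}\circ T(\mathrm{st}_{A,B})\circ\mathrm{st}'_{A,T(B)}$, both $T(A)\otimes T(B)\to T(A\otimes B)$; the strong monad is commutative when $\mathrm{dst}=\mathrm{dst}'$. The Kleisli category $\mathcal{C}_T$ has the objects of $\mathcal{C}$, morphisms $A\to B$ the morphisms $A\to T(B)$, identities $\eta$, composition $g\circ_T f=\mu\circ T(g)\circ f$; the canonical functor $\mathcal{C}\to\mathcal{C}_T$ sends $f\mapsto\eta\circ f$. *)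

theory Defs
  imports Main
begin

section \<open>Symmetric monoidal dagger categories\<close>

text \<open>
  The data of a symmetric monoidal dagger category; the locales below state the laws layer by
  layer. The composite \<open>g \<cdot> f\<close> (first \<open>f\<close>, then \<open>g\<close>) is constrained only for \<open>Dom g = Cod f\<close>. The associator goes from \<open>A \<odot> (B \<odot> C)\<close> to \<open>(A \<odot> B) \<odot> C\<close>, which is the
  direction in which the associativity law of a strength below is well-typed.
\<close>

record ('o, 'm) cat_data =
  Ob :: "'o set"
  Arr :: "'m set"
  Dom :: "'m \<Rightarrow> 'o"
  Cod :: "'m \<Rightarrow> 'o"
  Id :: "'o \<Rightarrow> 'm" (\<open>\<i>\<index>\<close>)
  Comp :: "'m \<Rightarrow> 'm \<Rightarrow> 'm" (infixr \<open>\<cdot>\<index>\<close> 65)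
  Unit :: "'o" (\<open>\<I>\<index>\<close>)
  TensorOb :: "'o \<Rightarrow> 'o \<Rightarrow> 'o" (infixr \<open>\<odot>\<index>\<close> 75)
  TensorArr :: "'m \<Rightarrow> 'm \<Rightarrow> 'm" (infixr \<open>\<otimes>\<index>\<close> 75)
  Assoc :: "'o \<Rightarrow> 'o \<Rightarrow> 'o \<Rightarrow> 'm" (\<open>\<a>\<index>\<close>)
  LUnit :: "'o \<Rightarrow> 'm" (\<open>\<l>\<index>\<close>)
  RUnit :: "'o \<Rightarrow> 'm" (\<open>\<r>\<index>\<close>)
  Sym :: "'o \<Rightarrow> 'o \<Rightarrow> 'm" (\<open>\<s>\<index>\<close>)
  Dagger :: "'m \<Rightarrow> 'm" (\<open>_\<dagger>\<index>\<close> [1000] 999)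

definition Hom :: "('o, 'm, 'z) cat_data_scheme \<Rightarrow> 'o \<Rightarrow> 'o \<Rightarrow> 'm set" where
  "Hom C A B = {f \<in> Arr C. Dom C f = A \<and> Cod C f = B}"

definition inverse_arrows :: "('o, 'm, 'z) cat_data_scheme \<Rightarrow> 'm \<Rightarrow> 'm \<Rightarrow> bool" where
  "inverse_arrows C f g \<longleftrightarrow>
     f \<in> Arr C \<and> g \<in> Hom C (Cod C f) (Dom C f) \<and>
     g \<cdot>\<^bsub>C\<^esub> f = \<i>\<^bsub>C\<^esub> (Dom C f) \<and> f \<cdot>\<^bsub>C\<^esub> g = \<i>\<^bsub>C\<^esub> (Cod C f)"

definition is_iso :: "('o, 'm, 'z) cat_data_scheme \<Rightarrow> 'm \<Rightarrow> bool" where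
  "is_iso C f \<longleftrightarrow> (\<exists>g. inverse_arrows C f g)"

definition unitary :: "('o, 'm, 'z) cat_data_scheme \<Rightarrow> 'm \<Rightarrow> bool" where
  "unitary C f \<longleftrightarrow> inverse_arrows C f (f\<dagger>\<^bsub>C\<^esub>)"

locale category =
  fixes C :: "('o, 'm, 'z) cat_data_scheme" (structure)
  assumes Dom_Ob: "f \<in> Arr C \<Longrightarrow> Dom C f \<in> Ob C"
    and Cod_Ob: "f \<in> Arr C \<Longrightarrow> Cod C f \<in> Ob C"
    and Id_Hom: "A \<in> Ob C \<Longrightarrow> \<i> A \<in> Hom C A A"
    and Comp_Hom: "f \<in> Hom C A B \<Longrightarrow> g \<in> Hom C B D \<Longrightarrow> g \<cdot> f \<in> Hom C A D"
    and Comp_Id_right: "f \<in> Hom C A B \<Longrightarrow> f \<cdot> \<i> A = f"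
    and Comp_Id_left: "f \<in> Hom C A B \<Longrightarrow> \<i> B \<cdot> f = f"
    and Comp_assoc: "f \<in> Hom C A B \<Longrightarrow> g \<in> Hom C B D \<Longrightarrow> h \<in> Hom C D E \<Longrightarrow>
      (h \<cdot> g) \<cdot> f = h \<cdot> (g \<cdot> f)"

locale monoidal_category = category +
  assumes Unit_Ob: "\<I> \<in> Ob C"
    and TensorOb_Ob: "A \<in> Ob C \<Longrightarrow> B \<in> Ob C \<Longrightarrow> A \<odot> B \<in> Ob C"
    and TensorArr_Hom: "f \<in> Hom C A B \<Longrightarrow> g \<in> Hom C A' B' \<Longrightarrow>
      f \<otimes> g \<in> Hom C (A \<odot> A') (B \<odot> B')"
    and TensorArr_Id: "A \<in> Ob C \<Longrightarrow> B \<in> Ob C \<Longrightarrow> \<i> A \<otimes> \<i> B = \<i> (A \<odot> B)"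
    and TensorArr_Comp: "f \<in> Hom C A B \<Longrightarrow> g \<in> Hom C B D \<Longrightarrow>
      f' \<in> Hom C A' B' \<Longrightarrow> g' \<in> Hom C B' D' \<Longrightarrow>
      (g \<cdot> f) \<otimes> (g' \<cdot> f') = (g \<otimes> g') \<cdot> (f \<otimes> f')"
    and Assoc_Hom: "A \<in> Ob C \<Longrightarrow> B \<in> Ob C \<Longrightarrow> D \<in> Ob C \<Longrightarrow>
      \<a> A B D \<in> Hom C (A \<odot> (B \<odot> D)) ((A \<odot> B) \<odot> D)"
    and Assoc_iso: "A \<in> Ob C \<Longrightarrow> B \<in> Ob C \<Longrightarrow> D \<in> Ob C \<Longrightarrow> is_iso C (\<a> A B D)"
    and Assoc_natural: "f \<in> Hom C A A' \<Longrightarrow> g \<in> Hom C B B' \<Longrightarrow> h \<in> Hom C D D' \<Longrightarrow>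
      \<a> A' B' D' \<cdot> (f \<otimes> (g \<otimes> h)) = ((f \<otimes> g) \<otimes> h) \<cdot> \<a> A B D"
    and LUnit_Hom: "A \<in> Ob C \<Longrightarrow> \<l> A \<in> Hom C (\<I> \<odot> A) A"
    and LUnit_iso: "A \<in> Ob C \<Longrightarrow> is_iso C (\<l> A)"
    and LUnit_natural: "f \<in> Hom C A B \<Longrightarrow> \<l> B \<cdot> (\<i> \<I> \<otimes> f) = f \<cdot> \<l> A"
    and RUnit_Hom: "A \<in> Ob C \<Longrightarrow> \<r> A \<in> Hom C (A \<odot> \<I>) A"
    and RUnit_iso: "A \<in> Ob C \<Longrightarrow> is_iso C (\<r> A)"
    and RUnit_natural: "f \<in> Hom C A B \<Longrightarrow> \<r> B \<cdot> (f \<otimes> \<i> \<I>) = f \<cdot> \<r> A"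
    and pentagon: "A \<in> Ob C \<Longrightarrow> B \<in> Ob C \<Longrightarrow> D \<in> Ob C \<Longrightarrow> E \<in> Ob C \<Longrightarrow>
      \<a> (A \<odot> B) D E \<cdot> \<a> A B (D \<odot> E) =
      (\<a> A B D \<otimes> \<i> E) \<cdot> \<a> A (B \<odot> D) E \<cdot> (\<i> A \<otimes> \<a> B D E)"
    and triangle: "A \<in> Ob C \<Longrightarrow> B \<in> Ob C \<Longrightarrow>
      (\<r> A \<otimes> \<i> B) \<cdot> \<a> A \<I> B = \<i> A \<otimes> \<l> B"

locale symmetric_monoidal_category = monoidal_category +
  assumes Sym_Hom: "A \<in> Ob C \<Longrightarrow> B \<in> Ob C \<Longrightarrow> \<s> A B \<in> Hom C (A \<odot> B) (B \<odot> A)"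
    and Sym_natural: "f \<in> Hom C A A' \<Longrightarrow> g \<in> Hom C B B' \<Longrightarrow>
      \<s> A' B' \<cdot> (f \<otimes> g) = (g \<otimes> f) \<cdot> \<s> A B"
    and Sym_Sym: "A \<in> Ob C \<Longrightarrow> B \<in> Ob C \<Longrightarrow> \<s> B A \<cdot> \<s> A B = \<i> (A \<odot> B)"
    and hexagon: "A \<in> Ob C \<Longrightarrow> B \<in> Ob C \<Longrightarrow> D \<in> Ob C \<Longrightarrow>
      \<a> D A B \<cdot> \<s> (A \<odot> B) D \<cdot> \<a> A B D =
      (\<s> A D \<otimes> \<i> B) \<cdot> \<a> A D B \<cdot> (\<i> A \<otimes> \<s> B D)"

locale dagger_category = category +
  assumes Dagger_Hom: "f \<in> Hom C A B \<Longrightarrow> f\<dagger> \<in> Hom C B A"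
    and Dagger_Id: "A \<in> Ob C \<Longrightarrow> (\<i> A)\<dagger> = \<i> A"
    and Dagger_Comp: "f \<in> Hom C A B \<Longrightarrow> g \<in> Hom C B D \<Longrightarrow> (g \<cdot> f)\<dagger> = f\<dagger> \<cdot> g\<dagger>"
    and Dagger_Dagger: "f \<in> Arr C \<Longrightarrow> (f\<dagger>)\<dagger> = f"

locale symmetric_monoidal_dagger_category = symmetric_monoidal_category + dagger_category +
  assumes Dagger_TensorArr: "f \<in> Arr C \<Longrightarrow> g \<in> Arr C \<Longrightarrow> (f \<otimes> g)\<dagger> = f\<dagger> \<otimes> g\<dagger>"
    and Assoc_unitary: "A \<in> Ob C \<Longrightarrow> B \<in> Ob C \<Longrightarrow> D \<in> Ob C \<Longrightarrow> unitary C (\<a> A B D)"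
    and LUnit_unitary: "A \<in> Ob C \<Longrightarrow> unitary C (\<l> A)"
    and RUnit_unitary: "A \<in> Ob C \<Longrightarrow> unitary C (\<r> A)"
    and Sym_unitary: "A \<in> Ob C \<Longrightarrow> B \<in> Ob C \<Longrightarrow> unitary C (\<s> A B)"


section \<open>Commutative strong Frobenius monads\<close>

record ('o, 'm) monad_data =
  TOb :: "'o \<Rightarrow> 'o"
  TArr :: "'m \<Rightarrow> 'm"
  mult :: "'o \<Rightarrow> 'm"
  unit :: "'o \<Rightarrow> 'm"

record ('o, 'm) strong_monad_data = "('o, 'm) monad_data" +
  strength :: "'o \<Rightarrow> 'o \<Rightarrow> 'm"

locale monad = category C for C :: "('o, 'm, 'z) cat_data_scheme" (structure) +
  fixes T :: "('o, 'm, 'y) monad_data_scheme"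
  assumes TOb_Ob: "A \<in> Ob C \<Longrightarrow> TOb T A \<in> Ob C"
    and TArr_Hom: "f \<in> Hom C A B \<Longrightarrow> TArr T f \<in> Hom C (TOb T A) (TOb T B)"
    and TArr_Id: "A \<in> Ob C \<Longrightarrow> TArr T (\<i> A) = \<i> (TOb T A)"
    and TArr_Comp: "f \<in> Hom C A B \<Longrightarrow> g \<in> Hom C B D \<Longrightarrow>
      TArr T (g \<cdot> f) = TArr T g \<cdot> TArr T f"
    and mult_Hom: "A \<in> Ob C \<Longrightarrow> mult T A \<in> Hom C (TOb T (TOb T A)) (TOb T A)"
    and mult_natural: "f \<in> Hom C A B \<Longrightarrow>
      mult T B \<cdot> TArr T (TArr T f) = TArr T f \<cdot> mult T A"
    and unit_Hom: "A \<in> Ob C \<Longrightarrow> unit T A \<in> Hom C A (TOb T A)"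
    and unit_natural: "f \<in> Hom C A B \<Longrightarrow> unit T B \<cdot> f = TArr T f \<cdot> unit T A"
    and mult_assoc: "A \<in> Ob C \<Longrightarrow>
      mult T A \<cdot> TArr T (mult T A) = mult T A \<cdot> mult T (TOb T A)"
    and mult_unit_left: "A \<in> Ob C \<Longrightarrow> mult T A \<cdot> unit T (TOb T A) = \<i> (TOb T A)"
    and mult_unit_right: "A \<in> Ob C \<Longrightarrow> mult T A \<cdot> TArr T (unit T A) = \<i> (TOb T A)"

locale frobenius_monad = dagger_category C + monad C T
  for C :: "('o, 'm, 'z) cat_data_scheme" (structure)
    and T :: "('o, 'm, 'y) monad_data_scheme" +
  assumes TArr_Dagger: "f \<in> Arr C \<Longrightarrow> TArr T (f\<dagger>) = (TArr T f)\<dagger>"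
    and frobenius_law: "A \<in> Ob C \<Longrightarrow>
      TArr T (mult T A) \<cdot> (mult T (TOb T A))\<dagger> = mult T (TOb T A) \<cdot> TArr T ((mult T A)\<dagger>)"

locale strong_monad = monoidal_category C + monad C T
  for C :: "('o, 'm, 'z) cat_data_scheme" (structure)
    and T :: "('o, 'm, 'y) strong_monad_data_scheme" +
  assumes strength_Hom: "A \<in> Ob C \<Longrightarrow> B \<in> Ob C \<Longrightarrow>
      strength T A B \<in> Hom C (A \<odot> TOb T B) (TOb T (A \<odot> B))"
    and strength_natural: "f \<in> Hom C A A' \<Longrightarrow> g \<in> Hom C B B' \<Longrightarrow>
      strength T A' B' \<cdot> (f \<otimes> TArr T g) = TArr T (f \<otimes> g) \<cdot> strength T A B"
    and strength_Assoc: "A \<in> Ob C \<Longrightarrow> B \<in> Ob C \<Longrightarrow> D \<in> Ob C \<Longrightarrow>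
      strength T (A \<odot> B) D \<cdot> \<a> A B (TOb T D) =
      TArr T (\<a> A B D) \<cdot> strength T A (B \<odot> D) \<cdot> (\<i> A \<otimes> strength T B D)"
    and strength_LUnit: "A \<in> Ob C \<Longrightarrow> TArr T (\<l> A) \<cdot> strength T \<I> A = \<l> (TOb T A)"
    and strength_mult: "A \<in> Ob C \<Longrightarrow> B \<in> Ob C \<Longrightarrow>
      strength T A B \<cdot> (\<i> A \<otimes> mult T B) =
      mult T (A \<odot> B) \<cdot> TArr T (strength T A B) \<cdot> strength T A (TOb T B)"
    and strength_unit: "A \<in> Ob C \<Longrightarrow> B \<in> Ob C \<Longrightarrow>
      strength T A B \<cdot> (\<i> A \<otimes> unit T B) = unit T (A \<odot> B)"

locale strong_frobenius_monad =
  symmetric_monoidal_dagger_category C + frobenius_monad C T + strong_monad C T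
  for C :: "('o, 'm, 'z) cat_data_scheme" (structure)
    and T :: "('o, 'm, 'y) strong_monad_data_scheme" +
  assumes strength_unitary: "A \<in> Ob C \<Longrightarrow> B \<in> Ob C \<Longrightarrow> unitary C (strength T A B)"

definition strength' ::
    "('o, 'm, 'z) cat_data_scheme \<Rightarrow> ('o, 'm, 'y) strong_monad_data_scheme \<Rightarrow> 'o \<Rightarrow> 'o \<Rightarrow> 'm" where
  "strength' C T A B =
     TArr T (\<s>\<^bsub>C\<^esub> B A) \<cdot>\<^bsub>C\<^esub> strength T B A \<cdot>\<^bsub>C\<^esub> \<s>\<^bsub>C\<^esub> (TOb T A) B"

definition dst ::
    "('o, 'm, 'z) cat_data_scheme \<Rightarrow> ('o, 'm, 'y) strong_monad_data_scheme \<Rightarrow> 'o \<Rightarrow> 'o \<Rightarrow> 'm" where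
  "dst C T A B =
     mult T (A \<odot>\<^bsub>C\<^esub> B) \<cdot>\<^bsub>C\<^esub> TArr T (strength' C T A B) \<cdot>\<^bsub>C\<^esub> strength T (TOb T A) B"

definition dst' ::
    "('o, 'm, 'z) cat_data_scheme \<Rightarrow> ('o, 'm, 'y) strong_monad_data_scheme \<Rightarrow> 'o \<Rightarrow> 'o \<Rightarrow> 'm" where
  "dst' C T A B =
     mult T (A \<odot>\<^bsub>C\<^esub> B) \<cdot>\<^bsub>C\<^esub> TArr T (strength T A B) \<cdot>\<^bsub>C\<^esub> strength' C T A (TOb T B)"

locale commutative_strong_frobenius_monad = strong_frobenius_monad +
  assumes commutative: "A \<in> Ob C \<Longrightarrow> B \<in> Ob C \<Longrightarrow> dst C T A B = dst' C T A B"


section \<open>The Kleisli category\<close>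

text \<open>
  The objects \<open>TOb T B\<close> need not determine \<open>B\<close>, so an arrow \<open>f\<close> of \<open>C\<close> from \<open>A\<close> to \<open>TOb T B\<close>,
  regarded as an arrow from \<open>A\<close> to \<open>B\<close> of the Kleisli category, is represented as \<open>(A, f, B)\<close>.
\<close>

definition kleisli_embed ::
    "('o, 'm, 'z) cat_data_scheme \<Rightarrow> ('o, 'm, 'y) monad_data_scheme \<Rightarrow> 'm \<Rightarrow> 'o \<times> 'm \<times> 'o" where
  "kleisli_embed C T f = (Dom C f, unit T (Cod C f) \<cdot>\<^bsub>C\<^esub> f, Cod C f)"

definition kleisli ::
    "('o, 'm, 'z) cat_data_scheme \<Rightarrow> ('o, 'm, 'y) strong_monad_data_scheme \<Rightarrow>
     ('o, 'o \<times> 'm \<times> 'o) cat_data" where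
  "kleisli C T = \<lparr>
     Ob = Ob C,
     Arr = {(A, f, B). A \<in> Ob C \<and> B \<in> Ob C \<and> f \<in> Hom C A (TOb T B)},
     Dom = (\<lambda>(A, f, B). A),
     Cod = (\<lambda>(A, f, B). B),
     Id = (\<lambda>A. (A, unit T A, A)),
     Comp = (\<lambda>(B, g, D) (A, f, B'). (A, mult T D \<cdot>\<^bsub>C\<^esub> TArr T g \<cdot>\<^bsub>C\<^esub> f, D)),
     Unit = \<I>\<^bsub>C\<^esub>,
     TensorOb = (\<lambda>A B. A \<odot>\<^bsub>C\<^esub> B),
     TensorArr = (\<lambda>(A, f, B) (A', g, B').
       (A \<odot>\<^bsub>C\<^esub> A', dst C T B B' \<cdot>\<^bsub>C\<^esub> (f \<otimes>\<^bsub>C\<^esub> g), B \<odot>\<^bsub>C\<^esub> B')),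
     Assoc = (\<lambda>A B D. kleisli_embed C T (\<a>\<^bsub>C\<^esub> A B D)),
     LUnit = (\<lambda>A. kleisli_embed C T (\<l>\<^bsub>C\<^esub> A)),
     RUnit = (\<lambda>A. kleisli_embed C T (\<r>\<^bsub>C\<^esub> A)),
     Sym = (\<lambda>A B. kleisli_embed C T (\<s>\<^bsub>C\<^esub> A B)),
     Dagger = (\<lambda>(A, f, B). (B, TArr T (f\<dagger>\<^bsub>C\<^esub>) \<cdot>\<^bsub>C\<^esub> (mult T B)\<dagger>\<^bsub>C\<^esub> \<cdot>\<^bsub>C\<^esub> unit T B, A))
   \<rparr>"

end

theory Submission
  imports Defs
begin

text \<open>
  The strength lets one whisker a Kleisli arrow \<open>g : B \<rightarrow> T B'\<close> with an object \<open>A\<close> on the left,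
  as \<open>st \<circ> (A \<otimes> g)\<close>; conjugating with the symmetry gives whiskering on the right. Both are
  functorial, \<open>f \<otimes>\<^sub>T g\<close> is whiskering first \<open>g\<close> and then \<open>f\<close>, and commutativity of the monad
  says exactly that the order does not matter. The monoidal structure therefore follows from laws
  in a single variable, all of which reduce to the laws of the strength, and the coherence laws
  are images of those of the base category. The Frobenius law makes the proposed dagger an
  involutive contravariant functor extending that of the base category. As the strength is unitary
  it respects the comultiplication \<open>\<mu>\<^sup>\<dagger>\<close>, so the dagger commutes with whiskering and hence with
  the tensor.
\<close>

section \<open>Typed calculation in categories\<close>

context category
begin

lemma Comp_simps [simp]:
  assumes "f \<in> Arr C" "g \<in> Arr C" "Dom C g = Cod C f"
  shows "g \<cdot> f \<in> Arr C" "Dom C (g \<cdot> f) = Dom C f" "Cod C (g \<cdot> f) = Cod C g"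
  using Comp_Hom[of f "Dom C f" "Cod C f" g "Cod C g"] assms by (auto simp: Hom_def)

lemma Id_simps [simp]:
  assumes "A \<in> Ob C"
  shows "\<i> A \<in> Arr C" "Dom C (\<i> A) = A" "Cod C (\<i> A) = A"
  using Id_Hom[OF assms] by (auto simp: Hom_def)

lemma Comp_assoc_Arr [simp]:
  assumes "f \<in> Arr C" "g \<in> Arr C" "h \<in> Arr C" "Dom C g = Cod C f" "Dom C h = Cod C g"
  shows "(h \<cdot> g) \<cdot> f = h \<cdot> g \<cdot> f"
  using Comp_assoc[of f "Dom C f" "Cod C f" g "Cod C g" h "Cod C h"] assms by (auto simp: Hom_def)

lemma Comp_Id_Arr [simp]:
  assumes "f \<in> Arr C"
  shows "Dom C f = A \<Longrightarrow> f \<cdot> \<i> A = f" "Cod C f = A \<Longrightarrow> \<i> A \<cdot> f = f"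
  using Comp_Id_right[of f "Dom C f" "Cod C f"] Comp_Id_left[of f "Dom C f" "Cod C f"] assms
  by (auto simp: Hom_def)

lemma Dom_Cod_Ob [simp]: "f \<in> Arr C \<Longrightarrow> Dom C f \<in> Ob C" "f \<in> Arr C \<Longrightarrow> Cod C f \<in> Ob C"
  by (auto intro: Dom_Ob Cod_Ob)

text \<open>Simplification keeps composites nested to the right, so a law about
  \<open>p \<cdot> q\<close> does not match inside \<open>p \<cdot> q \<cdot> x\<close>. This form
  lets such a law act at the head of a longer composite.\<close>

lemma Comp_extend:
  assumes "p \<cdot> q = r" "p \<in> Arr C" "q \<in> Arr C" "Dom C p = Cod C q"
    and "x \<in> Arr C" "Dom C q = Cod C x"
  shows "p \<cdot> q \<cdot> x = r \<cdot> x"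
  using assms Comp_assoc_Arr[of x q p] by simp

lemma iso_cancel_left:
  assumes "is_iso C p" "p \<cdot> f = p \<cdot> g" "f \<in> Arr C" "g \<in> Arr C"
    "Cod C f = Dom C p" "Cod C g = Dom C p"
  shows "f = g"
proof -
  obtain q where q: "p \<in> Arr C" "q \<in> Arr C" "Dom C q = Cod C p" "Cod C q = Dom C p"
      "q \<cdot> p = \<i> (Dom C p)"
    using assms(1) by (auto simp: is_iso_def inverse_arrows_def Hom_def)
  have "q \<cdot> p \<cdot> f = f" "q \<cdot> p \<cdot> g = g"
    using q assms(3-) Comp_extend[OF q(5)] by auto
  then show ?thesis
    using assms(2) by metis
qed

lemma iso_cancel_right:
  assumes "is_iso C p" "f \<cdot> p = g \<cdot> p" "f \<in> Arr C" "g \<in> Arr C"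
    "Dom C f = Cod C p" "Dom C g = Cod C p"
  shows "f = g"
proof -
  obtain q where q: "p \<in> Arr C" "q \<in> Arr C" "Dom C q = Cod C p" "Cod C q = Dom C p"
      "p \<cdot> q = \<i> (Cod C p)"
    using assms(1) by (auto simp: is_iso_def inverse_arrows_def Hom_def)
  have "(f \<cdot> p) \<cdot> q = f" "(g \<cdot> p) \<cdot> q = g"
    using q assms(3-) by auto
  then show ?thesis
    using assms(2) by metis
qed

lemma is_iso_Comp:
  assumes "is_iso C f" "is_iso C g" "Dom C g = Cod C f"
  shows "is_iso C (g \<cdot> f)"
proof -
  obtain f' where f': "f \<in> Arr C" "f' \<in> Arr C" "Dom C f' = Cod C f" "Cod C f' = Dom C f"
      "f' \<cdot> f = \<i> (Dom C f)" "f \<cdot> f' = \<i> (Cod C f)"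
    using assms(1) by (auto simp: is_iso_def inverse_arrows_def Hom_def)
  obtain g' where g': "g \<in> Arr C" "g' \<in> Arr C" "Dom C g' = Cod C g" "Cod C g' = Dom C g"
      "g' \<cdot> g = \<i> (Dom C g)" "g \<cdot> g' = \<i> (Cod C g)"
    using assms(2) by (auto simp: is_iso_def inverse_arrows_def Hom_def)
  have "inverse_arrows C (g \<cdot> f) (f' \<cdot> g')"
    using f' g' assms(3) Comp_extend[OF f'(6)] Comp_extend[OF g'(5)]
    by (auto simp: inverse_arrows_def Hom_def)
  then show ?thesis
    by (auto simp: is_iso_def)
qed

lemma is_iso_Id: "A \<in> Ob C \<Longrightarrow> is_iso C (\<i> A)"
  by (auto simp: is_iso_def inverse_arrows_def Hom_def intro!: exI[of _ "\<i> A"])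

end

section \<open>Coherence in monoidal categories\<close>

context monoidal_category
begin

lemma Unit_Ob_simp [simp]: "\<I> \<in> Ob C"
  by (rule Unit_Ob)

lemma TensorOb_simp [simp]: "A \<in> Ob C \<Longrightarrow> B \<in> Ob C \<Longrightarrow> A \<odot> B \<in> Ob C"
  by (rule TensorOb_Ob)

lemma TensorArr_simps [simp]:
  assumes "f \<in> Arr C" "g \<in> Arr C"
  shows "f \<otimes> g \<in> Arr C" "Dom C (f \<otimes> g) = Dom C f \<odot> Dom C g"
    "Cod C (f \<otimes> g) = Cod C f \<odot> Cod C g"
  using TensorArr_Hom[of f "Dom C f" "Cod C f" g "Dom C g" "Cod C g"] assms
  by (auto simp: Hom_def)

lemma Assoc_simps [simp]:
  assumes "A \<in> Ob C" "B \<in> Ob C" "D \<in> Ob C"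
  shows "\<a> A B D \<in> Arr C" "Dom C (\<a> A B D) = A \<odot> B \<odot> D" "Cod C (\<a> A B D) = (A \<odot> B) \<odot> D"
  using Assoc_Hom[OF assms] by (auto simp: Hom_def)

lemma LUnit_simps [simp]:
  assumes "A \<in> Ob C"
  shows "\<l> A \<in> Arr C" "Dom C (\<l> A) = \<I> \<odot> A" "Cod C (\<l> A) = A"
  using LUnit_Hom[OF assms] by (auto simp: Hom_def)

lemma RUnit_simps [simp]:
  assumes "A \<in> Ob C"
  shows "\<r> A \<in> Arr C" "Dom C (\<r> A) = A \<odot> \<I>" "Cod C (\<r> A) = A"
  using RUnit_Hom[OF assms] by (auto simp: Hom_def)

text \<open>Oriented to merge composites of tensors into a single tensor, the reverse of
  \<open>TensorArr_Comp\<close>.\<close>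

lemma interchange:
  assumes "f \<in> Arr C" "g \<in> Arr C" "Dom C g = Cod C f"
    and "f' \<in> Arr C" "g' \<in> Arr C" "Dom C g' = Cod C f'"
  shows "(g \<otimes> g') \<cdot> (f \<otimes> f') = (g \<cdot> f) \<otimes> (g' \<cdot> f')"
  using TensorArr_Comp[of f "Dom C f" "Cod C f" g "Cod C g" f' "Dom C f'" "Cod C f'" g' "Cod C g'"]
    assms by (auto simp: Hom_def)

lemmas interchange_extend = Comp_extend[OF interchange]

lemma TensorArr_Id_simp [simp]: "A \<in> Ob C \<Longrightarrow> B \<in> Ob C \<Longrightarrow> \<i> A \<otimes> \<i> B = \<i> (A \<odot> B)"
  by (rule TensorArr_Id)

lemma Assoc_natural_Arr:
  assumes "f \<in> Arr C" "g \<in> Arr C" "h \<in> Arr C"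
  shows "\<a> (Cod C f) (Cod C g) (Cod C h) \<cdot> (f \<otimes> g \<otimes> h) =
    ((f \<otimes> g) \<otimes> h) \<cdot> \<a> (Dom C f) (Dom C g) (Dom C h)"
  by (rule Assoc_natural) (use assms in \<open>auto simp: Hom_def\<close>)

lemma RUnit_natural_Arr: "f \<in> Arr C \<Longrightarrow> \<r> (Cod C f) \<cdot> (f \<otimes> \<i> \<I>) = f \<cdot> \<r> (Dom C f)"
  by (rule RUnit_natural) (auto simp: Hom_def)

lemma LUnit_natural_Arr: "f \<in> Arr C \<Longrightarrow> \<l> (Cod C f) \<cdot> (\<i> \<I> \<otimes> f) = f \<cdot> \<l> (Dom C f)"
  by (rule LUnit_natural) (auto simp: Hom_def)

text \<open>Naturality of the right unitor, which is invertible, conjugates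
  \<open>f \<otimes> \<i> \<I>\<close> into \<open>f\<close>; hence tensoring with the unit is
  faithful.\<close>

lemma TensorArr_Unit_cancel:
  assumes "f \<otimes> \<i> \<I> = g \<otimes> \<i> \<I>" "f \<in> Arr C" "g \<in> Arr C"
    "Dom C f = Dom C g" "Cod C f = Cod C g"
  shows "f = g"
proof (rule iso_cancel_right)
  show "is_iso C (\<r> (Dom C f))"
    using assms by (simp add: RUnit_iso)
  show "f \<cdot> \<r> (Dom C f) = g \<cdot> \<r> (Dom C f)"
    using RUnit_natural_Arr[of f] RUnit_natural_Arr[of g] assms by simp
qed (use assms in auto)

lemma Unit_TensorArr_cancel:
  assumes "\<i> \<I> \<otimes> f = \<i> \<I> \<otimes> g" "f \<in> Arr C" "g \<in> Arr C"
    "Dom C f = Dom C g" "Cod C f = Cod C g"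
  shows "f = g"
proof (rule iso_cancel_right)
  show "is_iso C (\<l> (Dom C f))"
    using assms by (simp add: LUnit_iso)
  show "f \<cdot> \<l> (Dom C f) = g \<cdot> \<l> (Dom C f)"
    using LUnit_natural_Arr[of f] LUnit_natural_Arr[of g] assms by simp
qed (use assms in auto)

lemma is_iso_TensorArr:
  assumes "is_iso C f" "is_iso C g"
  shows "is_iso C (f \<otimes> g)"
proof -
  obtain f' where f': "f \<in> Arr C" "f' \<in> Arr C" "Dom C f' = Cod C f" "Cod C f' = Dom C f"
      "f' \<cdot> f = \<i> (Dom C f)" "f \<cdot> f' = \<i> (Cod C f)"
    using assms(1) by (auto simp: is_iso_def inverse_arrows_def Hom_def)
  obtain g' where g': "g \<in> Arr C" "g' \<in> Arr C" "Dom C g' = Cod C g" "Cod C g' = Dom C g"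
      "g' \<cdot> g = \<i> (Dom C g)" "g \<cdot> g' = \<i> (Cod C g)"
    using assms(2) by (auto simp: is_iso_def inverse_arrows_def Hom_def)
  have "inverse_arrows C (f \<otimes> g) (f' \<otimes> g')"
    using f' g' by (auto simp: inverse_arrows_def Hom_def interchange)
  then show ?thesis
    by (auto simp: is_iso_def)
qed

text \<open>Kelly's argument: by faithfulness the equation may be tensored with the unit. There the
  pentagon for \<open>A\<close>, \<open>B\<close>, \<open>\<I>\<close>, \<open>\<I>\<close> is
  combined with the triangles for \<open>A \<odot> B\<close>, \<open>\<I>\<close> and for
  \<open>B\<close>, \<open>\<I>\<close>.\<close>

lemma RUnit_TensorOb:
  assumes [simp]: "A \<in> Ob C" "B \<in> Ob C"
  shows "\<r> (A \<odot> B) \<cdot> \<a> A B \<I> = \<i> A \<otimes> \<r> B"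
proof (rule TensorArr_Unit_cancel)
  \<comment> \<open>Two of the three associators on the long side of the pentagon. Being invertible,
    this composite can be cancelled once both sides have been extended by it.\<close>
  let ?X = "\<a> A (B \<odot> \<I>) \<I> \<cdot> (\<i> A \<otimes> \<a> B \<I> \<I>)"
  show "(\<r> (A \<odot> B) \<cdot> \<a> A B \<I>) \<otimes> \<i> \<I> = (\<i> A \<otimes> \<r> B) \<otimes> \<i> \<I>"
  proof (rule iso_cancel_right)
    show "is_iso C ?X"
      by (intro is_iso_Comp is_iso_TensorArr is_iso_Id Assoc_iso) auto
    have "((\<r> (A \<odot> B) \<cdot> \<a> A B \<I>) \<otimes> \<i> \<I>) \<cdot> ?X
        = (\<r> (A \<odot> B) \<otimes> \<i> \<I>) \<cdot> (\<a> A B \<I> \<otimes> \<i> \<I>) \<cdot> ?X"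
      by (simp add: interchange_extend)
    also have "\<dots> = (\<r> (A \<odot> B) \<otimes> \<i> \<I>) \<cdot> \<a> (A \<odot> B) \<I> \<I> \<cdot> \<a> A B (\<I> \<odot> \<I>)"
      by (simp add: pentagon)
    also have "\<dots> = (\<i> (A \<odot> B) \<otimes> \<l> \<I>) \<cdot> \<a> A B (\<I> \<odot> \<I>)"
      by (simp add: Comp_extend[OF triangle])
    also have "\<dots> = \<a> A B \<I> \<cdot> (\<i> A \<otimes> \<i> B \<otimes> \<l> \<I>)"
      using Assoc_natural_Arr[of "\<i> A" "\<i> B" "\<l> \<I>"] by simp
    also have "\<dots> = \<a> A B \<I> \<cdot> (\<i> A \<otimes> \<r> B \<otimes> \<i> \<I>) \<cdot> (\<i> A \<otimes> \<a> B \<I> \<I>)"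
      by (simp add: interchange triangle)
    also have "\<dots> = ((\<i> A \<otimes> \<r> B) \<otimes> \<i> \<I>) \<cdot> ?X"
      using Comp_extend[OF Assoc_natural_Arr[of "\<i> A" "\<r> B" "\<i> \<I>"], of "\<i> A \<otimes> \<a> B \<I> \<I>"]
      by simp
    finally show "((\<r> (A \<odot> B) \<cdot> \<a> A B \<I>) \<otimes> \<i> \<I>) \<cdot> ?X = ((\<i> A \<otimes> \<r> B) \<otimes> \<i> \<I>) \<cdot> ?X" .
  qed auto
qed auto

end

section \<open>Unitors and the symmetry\<close>

context symmetric_monoidal_category
begin

lemma Sym_simps [simp]:
  assumes "A \<in> Ob C" "B \<in> Ob C"
  shows "\<s> A B \<in> Arr C" "Dom C (\<s> A B) = A \<odot> B" "Cod C (\<s> A B) = B \<odot> A"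
  using Sym_Hom[OF assms] by (auto simp: Hom_def)

lemma Sym_natural_Arr:
  assumes "f \<in> Arr C" "g \<in> Arr C"
  shows "\<s> (Cod C f) (Cod C g) \<cdot> (f \<otimes> g) = (g \<otimes> f) \<cdot> \<s> (Dom C f) (Dom C g)"
  by (rule Sym_natural) (use assms in \<open>auto simp: Hom_def\<close>)

lemma Sym_iso: "A \<in> Ob C \<Longrightarrow> B \<in> Ob C \<Longrightarrow> is_iso C (\<s> A B)"
  by (auto simp: is_iso_def inverse_arrows_def Hom_def Sym_Sym intro!: exI[of _ "\<s> B A"])

text \<open>Apply the right unitor to the hexagon with the unit in the middle.\<close>

lemma LUnit_eq_RUnit_Sym:
  assumes [simp]: "D \<in> Ob C"
  shows "\<l> D = \<r> D \<cdot> \<s> \<I> D"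
proof (rule Unit_TensorArr_cancel)
  \<comment> \<open>The calculation below works with any object in this place; the unit is chosen so
    that the outer tensor factor can be cancelled by \<open>Unit_TensorArr_cancel\<close>.\<close>
  let ?A = "\<I>"
  have "\<s> ?A D \<cdot> (\<i> ?A \<otimes> \<l> D) = \<s> ?A D \<cdot> (\<r> ?A \<otimes> \<i> D) \<cdot> \<a> ?A \<I> D"
    by (simp add: triangle)
  also have "\<dots> = (\<i> D \<otimes> \<r> ?A) \<cdot> \<s> (?A \<odot> \<I>) D \<cdot> \<a> ?A \<I> D"
    using Comp_extend[OF Sym_natural_Arr[of "\<r> ?A" "\<i> D"], of "\<a> ?A \<I> D"] by simp
  also have "\<dots> = \<r> (D \<odot> ?A) \<cdot> \<a> D ?A \<I> \<cdot> \<s> (?A \<odot> \<I>) D \<cdot> \<a> ?A \<I> D"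
    using Comp_extend[OF RUnit_TensorOb[of D ?A], of "\<s> (?A \<odot> \<I>) D \<cdot> \<a> ?A \<I> D"] by simp
  also have "\<dots> = \<r> (D \<odot> ?A) \<cdot> (\<s> ?A D \<otimes> \<i> \<I>) \<cdot> \<a> ?A D \<I> \<cdot> (\<i> ?A \<otimes> \<s> \<I> D)"
    by (simp add: hexagon)
  also have "\<dots> = \<s> ?A D \<cdot> \<r> (?A \<odot> D) \<cdot> \<a> ?A D \<I> \<cdot> (\<i> ?A \<otimes> \<s> \<I> D)"
    using Comp_extend[OF RUnit_natural_Arr[of "\<s> ?A D"], of "\<a> ?A D \<I> \<cdot> (\<i> ?A \<otimes> \<s> \<I> D)"]
    by simp
  also have "\<dots> = \<s> ?A D \<cdot> (\<i> ?A \<otimes> (\<r> D \<cdot> \<s> \<I> D))"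
    using Comp_extend[OF RUnit_TensorOb[of ?A D], of "\<i> ?A \<otimes> \<s> \<I> D"]
    by (simp add: interchange)
  finally show "\<i> ?A \<otimes> \<l> D = \<i> ?A \<otimes> (\<r> D \<cdot> \<s> \<I> D)"
    by (rule iso_cancel_left[OF Sym_iso, rotated 2]) auto
qed auto

lemma RUnit_eq_LUnit_Sym: "D \<in> Ob C \<Longrightarrow> \<r> D = \<l> D \<cdot> \<s> D \<I>"
  by (simp add: LUnit_eq_RUnit_Sym Sym_Sym)

end

section \<open>Symmetric monoidal structure from one-sided whiskering\<close>

text \<open>
  \<open>J\<close> is an identity-on-objects functor into a category \<open>K\<close>, \<open>W A g\<close> stands for whiskering \<open>g\<close>
  with \<open>A\<close> on the left and \<open>V B f\<close> for whiskering \<open>f\<close> with \<open>B\<close> on the right. The last law says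
  that \<open>K\<close>, which is premonoidal by the preceding ones, is monoidal.
\<close>

locale whiskered_extension = C: symmetric_monoidal_category C + K: category K
  for C :: "('o, 'm, 'z) cat_data_scheme" and K :: "('o, 'k, 'w) cat_data_scheme" (structure) +
  fixes J :: "'m \<Rightarrow> 'k" and W V :: "'o \<Rightarrow> 'k \<Rightarrow> 'k"
  assumes Ob_eq [simp]: "Ob K = Ob C"
    and Unit_eq [simp]: "\<I> = \<I>\<^bsub>C\<^esub>"
    and TensorOb_eq [simp]: "A \<odot> B = A \<odot>\<^bsub>C\<^esub> B"
    and Assoc_eq: "\<a> A B D = J (\<a>\<^bsub>C\<^esub> A B D)"
    and LUnit_eq: "\<l> A = J (\<l>\<^bsub>C\<^esub> A)"
    and RUnit_eq: "\<r> A = J (\<r>\<^bsub>C\<^esub> A)"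
    and Sym_eq: "\<s> A B = J (\<s>\<^bsub>C\<^esub> A B)"
    and TensorArr_eq: "f \<in> Hom K A A' \<Longrightarrow> g \<in> Hom K B B' \<Longrightarrow> f \<otimes> g = V B' f \<cdot> W A g"
    and J_Hom: "u \<in> Hom C A B \<Longrightarrow> J u \<in> Hom K A B"
    and J_Id: "A \<in> Ob C \<Longrightarrow> J (\<i>\<^bsub>C\<^esub> A) = \<i> A"
    and J_Comp: "u \<in> Hom C A B \<Longrightarrow> v \<in> Hom C B D \<Longrightarrow> J (v \<cdot>\<^bsub>C\<^esub> u) = J v \<cdot> J u"
    and W_Hom: "A \<in> Ob C \<Longrightarrow> g \<in> Hom K B B' \<Longrightarrow> W A g \<in> Hom K (A \<odot> B) (A \<odot> B')"
    and W_Comp: "A \<in> Ob C \<Longrightarrow> g \<in> Hom K B B' \<Longrightarrow> h \<in> Hom K B' B'' \<Longrightarrow>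
      W A (h \<cdot> g) = W A h \<cdot> W A g"
    and W_J: "A \<in> Ob C \<Longrightarrow> u \<in> Hom C B B' \<Longrightarrow> W A (J u) = J (\<i>\<^bsub>C\<^esub> A \<otimes>\<^bsub>C\<^esub> u)"
    and W_natural: "u \<in> Hom C A A' \<Longrightarrow> g \<in> Hom K B B' \<Longrightarrow>
      J (u \<otimes>\<^bsub>C\<^esub> \<i>\<^bsub>C\<^esub> B') \<cdot> W A g = W A' g \<cdot> J (u \<otimes>\<^bsub>C\<^esub> \<i>\<^bsub>C\<^esub> B)"
    and W_Assoc: "A \<in> Ob C \<Longrightarrow> B \<in> Ob C \<Longrightarrow> h \<in> Hom K D D' \<Longrightarrow>
      J (\<a>\<^bsub>C\<^esub> A B D') \<cdot> W A (W B h) = W (A \<odot> B) h \<cdot> J (\<a>\<^bsub>C\<^esub> A B D)"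
    and W_LUnit: "g \<in> Hom K B B' \<Longrightarrow> J (\<l>\<^bsub>C\<^esub> B') \<cdot> W \<I> g = g \<cdot> J (\<l>\<^bsub>C\<^esub> B)"
    and V_eq: "B \<in> Ob C \<Longrightarrow> f \<in> Hom K A A' \<Longrightarrow>
      V B f = J (\<s>\<^bsub>C\<^esub> B A') \<cdot> W B f \<cdot> J (\<s>\<^bsub>C\<^esub> A B)"
    and V_W: "f \<in> Hom K A A' \<Longrightarrow> g \<in> Hom K B B' \<Longrightarrow> V B' f \<cdot> W A g = W A' g \<cdot> V B f"
begin

lemma J_simps [simp]:
  assumes "f \<in> Arr C"
  shows "J f \<in> Arr K" "Dom K (J f) = Dom C f" "Cod K (J f) = Cod C f"
  using J_Hom[of f "Dom C f" "Cod C f"] assms by (auto simp: Hom_def)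

lemma W_simps [simp]:
  assumes "A \<in> Ob C" "g \<in> Arr K"
  shows "W A g \<in> Arr K" "Dom K (W A g) = A \<odot>\<^bsub>C\<^esub> Dom K g" "Cod K (W A g) = A \<odot>\<^bsub>C\<^esub> Cod K g"
  using W_Hom[of A g "Dom K g" "Cod K g"] assms by (auto simp: Hom_def)

lemma Dom_Cod_Ob_C [simp]: "f \<in> Arr K \<Longrightarrow> Dom K f \<in> Ob C" "f \<in> Arr K \<Longrightarrow> Cod K f \<in> Ob C"
  using K.Dom_Ob K.Cod_Ob by auto

lemma Hom_self: "f \<in> Arr K \<Longrightarrow> f \<in> Hom K (Dom K f) (Cod K f)"
  by (simp add: Hom_def)

lemma C_Hom_self: "f \<in> Arr C \<Longrightarrow> f \<in> Hom C (Dom C f) (Cod C f)"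
  by (simp add: Hom_def)

lemmas V_eq_Arr = V_eq[OF _ Hom_self]

lemma V_simps [simp]:
  assumes "B \<in> Ob C" "f \<in> Arr K"
  shows "V B f \<in> Arr K" "Dom K (V B f) = Dom K f \<odot>\<^bsub>C\<^esub> B" "Cod K (V B f) = Cod K f \<odot>\<^bsub>C\<^esub> B"
  using assms by (simp_all add: V_eq_Arr)

text \<open>Gathers adjacent images under \<open>J\<close> into one image, so that an equation
  between them can be checked in \<open>C\<close>. Used backwards, it splits them again.\<close>

lemma J_merge:
  assumes "f \<in> Arr C" "g \<in> Arr C" "Dom C g = Cod C f"
  shows "J g \<cdot> J f = J (g \<cdot>\<^bsub>C\<^esub> f)"
  using J_Comp[of f "Dom C f" "Cod C f" g "Cod C g"] assms by (simp add: Hom_def)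

lemmas J_merge_extend = K.Comp_extend[OF J_merge]

lemma W_Comp_Arr:
  assumes "A \<in> Ob C" "g \<in> Arr K" "h \<in> Arr K" "Dom K h = Cod K g"
  shows "W A (h \<cdot> g) = W A h \<cdot> W A g"
  using W_Comp[of A g "Dom K g" "Cod K g" h "Cod K h"] assms by (simp add: Hom_def)

lemma W_J_Arr: "A \<in> Ob C \<Longrightarrow> g \<in> Arr C \<Longrightarrow> W A (J g) = J (\<i>\<^bsub>C\<^esub> A \<otimes>\<^bsub>C\<^esub> g)"
  by (rule W_J[OF _ C_Hom_self])

section \<open>Right whiskering as a conjugate of left whiskering\<close>

lemma Sym_V:
  assumes "B \<in> Ob C" "f \<in> Hom K A A'"
  shows "J (\<s>\<^bsub>C\<^esub> A' B) \<cdot> V B f = W B f \<cdot> J (\<s>\<^bsub>C\<^esub> A B)"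
  using assms by (auto simp: V_eq_Arr Hom_def J_merge_extend C.Sym_Sym J_Id)

lemma V_Sym:
  assumes "B \<in> Ob C" "f \<in> Hom K A A'"
  shows "V B f \<cdot> J (\<s>\<^bsub>C\<^esub> B A) = J (\<s>\<^bsub>C\<^esub> B A') \<cdot> W B f"
  using assms by (auto simp: V_eq_Arr Hom_def J_merge C.Sym_Sym J_Id)

text \<open>In a product of two conjugates the inner symmetries cancel, which leaves functoriality
  of \<open>W\<close>.\<close>

lemma V_Comp:
  assumes "B \<in> Ob C" "g \<in> Arr K" "h \<in> Arr K" "Dom K h = Cod K g"
  shows "V B (h \<cdot> g) = V B h \<cdot> V B g"
proof -
  have "V B h \<cdot> V B g =
      V B h \<cdot> J (\<s>\<^bsub>C\<^esub> B (Dom K h)) \<cdot> W B g \<cdot> J (\<s>\<^bsub>C\<^esub> (Dom K g) B)"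
    using assms by (simp add: V_eq_Arr)
  also have "\<dots> = J (\<s>\<^bsub>C\<^esub> B (Cod K h)) \<cdot> W B h \<cdot> W B g \<cdot> J (\<s>\<^bsub>C\<^esub> (Dom K g) B)"
    using assms
      K.Comp_extend[OF V_Sym[OF _ Hom_self, of B h], of "W B g \<cdot> J (\<s>\<^bsub>C\<^esub> (Dom K g) B)"]
    by simp
  finally show ?thesis
    using assms by (simp add: V_eq_Arr W_Comp_Arr)
qed

lemma V_J:
  assumes "B \<in> Ob C" "f \<in> Arr C"
  shows "V B (J f) = J (f \<otimes>\<^bsub>C\<^esub> \<i>\<^bsub>C\<^esub> B)"
proof -
  have "V B (J f) = J (\<s>\<^bsub>C\<^esub> B (Cod C f) \<cdot>\<^bsub>C\<^esub> (\<i>\<^bsub>C\<^esub> B \<otimes>\<^bsub>C\<^esub> f) \<cdot>\<^bsub>C\<^esub> \<s>\<^bsub>C\<^esub> (Dom C f) B)"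
    using assms by (simp add: V_eq_Arr W_J_Arr J_merge)
  also have "\<dots> = J (\<s>\<^bsub>C\<^esub> B (Cod C f) \<cdot>\<^bsub>C\<^esub> \<s>\<^bsub>C\<^esub> (Cod C f) B \<cdot>\<^bsub>C\<^esub> (f \<otimes>\<^bsub>C\<^esub> \<i>\<^bsub>C\<^esub> B))"
    using assms C.Sym_natural_Arr[of f "\<i>\<^bsub>C\<^esub> B"] by simp
  finally show ?thesis
    using assms by (simp add: C.Comp_extend[OF C.Sym_Sym])
qed

text \<open>Identities are images under \<open>J\<close>, so preservation of identities is an
  instance of \<open>W_J\<close> and need not be a separate law.\<close>

lemma W_Id: "A \<in> Ob C \<Longrightarrow> B \<in> Ob C \<Longrightarrow> W A (\<i> B) = \<i> (A \<odot>\<^bsub>C\<^esub> B)"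
  by (simp add: W_J_Arr flip: J_Id)

lemma V_Id: "A \<in> Ob C \<Longrightarrow> B \<in> Ob C \<Longrightarrow> V B (\<i> A) = \<i> (A \<odot>\<^bsub>C\<^esub> B)"
  by (simp add: V_J flip: J_Id)

lemma TensorArr_eq_Arr:
  assumes "f \<in> Arr K" "g \<in> Arr K"
  shows "f \<otimes> g = V (Cod K g) f \<cdot> W (Dom K f) g"
  using TensorArr_eq assms by (simp add: Hom_def)

text \<open>Together with \<open>J_merge\<close> this turns each coherence equation of
  \<open>K\<close> into the image of the same equation of \<open>C\<close>.\<close>

lemma TensorArr_J: "f \<in> Arr C \<Longrightarrow> g \<in> Arr C \<Longrightarrow> J f \<otimes> J g = J (f \<otimes>\<^bsub>C\<^esub> g)"
  by (simp add: TensorArr_eq_Arr V_J W_J_Arr J_merge C.interchange)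

lemma is_iso_J:
  assumes "is_iso C f"
  shows "is_iso K (J f)"
proof -
  obtain g where "inverse_arrows C f g"
    using assms by (auto simp: is_iso_def)
  then have "inverse_arrows K (J f) (J g)"
    by (auto simp: inverse_arrows_def Hom_def J_merge J_Id)
  then show ?thesis
    by (auto simp: is_iso_def)
qed

text \<open>Naturality of the associator in its middle variable. Conjugating with the symmetry moves
  \<open>g\<close> to the last tensor factor, where \<open>W_Assoc\<close> and
  \<open>W_natural\<close> apply, and the hexagon relates the two rearrangements.\<close>

lemma W_V_Assoc:
  assumes [simp]: "A \<in> Ob C" "D \<in> Ob C" and g: "g \<in> Hom K B B'"
  shows "J (\<a>\<^bsub>C\<^esub> A B' D) \<cdot> W A (V D g) = V D (W A g) \<cdot> J (\<a>\<^bsub>C\<^esub> A B D)"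
proof -
  have [simp]: "g \<in> Arr K" "Dom K g = B" "Cod K g = B'" "B \<in> Ob C" "B' \<in> Ob C"
    using g by (auto simp: Hom_def)
  \<comment> \<open>Both composites start at \<open>A \<odot> (D \<odot> B)\<close> and bring
    \<open>D\<close> to the front: \<open>?h\<close> first swaps \<open>D\<close> with
    \<open>B\<close> and then moves it past \<open>A \<odot> B\<close>, while \<open>?k\<close>
    moves it past \<open>A\<close> alone. The hexagon makes them agree up to an associator.\<close>
  let ?h = "\<lambda>B. \<s>\<^bsub>C\<^esub> (A \<odot>\<^bsub>C\<^esub> B) D \<cdot>\<^bsub>C\<^esub> \<a>\<^bsub>C\<^esub> A B D \<cdot>\<^bsub>C\<^esub> (\<i>\<^bsub>C\<^esub> A \<otimes>\<^bsub>C\<^esub> \<s>\<^bsub>C\<^esub> D B)"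
  let ?k = "\<lambda>B. (\<s>\<^bsub>C\<^esub> A D \<otimes>\<^bsub>C\<^esub> \<i>\<^bsub>C\<^esub> B) \<cdot>\<^bsub>C\<^esub> \<a>\<^bsub>C\<^esub> A D B"
  have hex: "\<a>\<^bsub>C\<^esub> D A B \<cdot>\<^bsub>C\<^esub> ?h B = ?k B" if [simp]: "B \<in> Ob C" for B
  proof -
    have "\<a>\<^bsub>C\<^esub> D A B \<cdot>\<^bsub>C\<^esub> ?h B =
        (\<a>\<^bsub>C\<^esub> D A B \<cdot>\<^bsub>C\<^esub> \<s>\<^bsub>C\<^esub> (A \<odot>\<^bsub>C\<^esub> B) D \<cdot>\<^bsub>C\<^esub> \<a>\<^bsub>C\<^esub> A B D) \<cdot>\<^bsub>C\<^esub> (\<i>\<^bsub>C\<^esub> A \<otimes>\<^bsub>C\<^esub> \<s>\<^bsub>C\<^esub> D B)"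
      by simp
    also have "\<dots> = ?k B"
      unfolding C.hexagon[OF \<open>A \<in> Ob C\<close> \<open>B \<in> Ob C\<close> \<open>D \<in> Ob C\<close>]
      by (simp add: C.interchange C.Sym_Sym)
    finally show ?thesis .
  qed
  have "J (\<a>\<^bsub>C\<^esub> D A B') \<cdot> J (?h B') \<cdot> W A (W D g) = J (?k B') \<cdot> W A (W D g)"
    by (simp add: J_merge_extend hex)
  also have "\<dots> = J (\<s>\<^bsub>C\<^esub> A D \<otimes>\<^bsub>C\<^esub> \<i>\<^bsub>C\<^esub> B') \<cdot> J (\<a>\<^bsub>C\<^esub> A D B') \<cdot> W A (W D g)"
    by (simp flip: J_merge)
  also have "\<dots> = J (\<s>\<^bsub>C\<^esub> A D \<otimes>\<^bsub>C\<^esub> \<i>\<^bsub>C\<^esub> B') \<cdot> W (A \<odot> D) g \<cdot> J (\<a>\<^bsub>C\<^esub> A D B)"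
    using W_Assoc[OF _ _ g, of A D] by simp
  also have "\<dots> = W (D \<odot> A) g \<cdot> J (\<s>\<^bsub>C\<^esub> A D \<otimes>\<^bsub>C\<^esub> \<i>\<^bsub>C\<^esub> B) \<cdot> J (\<a>\<^bsub>C\<^esub> A D B)"
    using K.Comp_extend[OF W_natural[OF C.Sym_Hom[of A D] g], of "J (\<a>\<^bsub>C\<^esub> A D B)"] by simp
  also have "\<dots> = W (D \<odot> A) g \<cdot> J (\<a>\<^bsub>C\<^esub> D A B) \<cdot> J (?h B)"
    by (simp add: J_merge hex)
  also have "\<dots> = J (\<a>\<^bsub>C\<^esub> D A B') \<cdot> W D (W A g) \<cdot> J (?h B)"
    using K.Comp_extend[OF W_Assoc[OF _ _ g, of D A], of "J (?h B)"] by simp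
  finally have *: "J (?h B') \<cdot> W A (W D g) = W D (W A g) \<cdot> J (?h B)"
    by (rule K.iso_cancel_left[OF is_iso_J[OF C.Assoc_iso], rotated 3]) auto
  have "J (\<a>\<^bsub>C\<^esub> A B' D) \<cdot> W A (V D g) =
      J (\<a>\<^bsub>C\<^esub> A B' D \<cdot>\<^bsub>C\<^esub> (\<i>\<^bsub>C\<^esub> A \<otimes>\<^bsub>C\<^esub> \<s>\<^bsub>C\<^esub> D B')) \<cdot> W A (W D g) \<cdot> J (\<i>\<^bsub>C\<^esub> A \<otimes>\<^bsub>C\<^esub> \<s>\<^bsub>C\<^esub> B D)"
    by (simp add: V_eq_Arr W_Comp_Arr W_J_Arr J_merge_extend)
  also have "\<dots> = J (\<s>\<^bsub>C\<^esub> D (A \<odot>\<^bsub>C\<^esub> B')) \<cdot> J (?h B') \<cdot> W A (W D g) \<cdot> J (\<i>\<^bsub>C\<^esub> A \<otimes>\<^bsub>C\<^esub> \<s>\<^bsub>C\<^esub> B D)"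
    by (simp add: J_merge_extend C.Comp_extend[OF C.Sym_Sym])
  also have "\<dots> = J (\<s>\<^bsub>C\<^esub> D (A \<odot>\<^bsub>C\<^esub> B')) \<cdot> W D (W A g) \<cdot> J (?h B) \<cdot> J (\<i>\<^bsub>C\<^esub> A \<otimes>\<^bsub>C\<^esub> \<s>\<^bsub>C\<^esub> B D)"
    using K.Comp_extend[OF *, of "J (\<i>\<^bsub>C\<^esub> A \<otimes>\<^bsub>C\<^esub> \<s>\<^bsub>C\<^esub> B D)"] by simp
  also have "\<dots> = V D (W A g) \<cdot> J (\<a>\<^bsub>C\<^esub> A B D)"
    by (simp add: V_eq_Arr J_merge C.interchange C.Sym_Sym)
  finally show ?thesis .
qed

text \<open>Naturality of the associator in its first variable, reduced by the hexagon to the middle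
  variable (\<open>W_V_Assoc\<close>) and the last one (\<open>W_Assoc\<close>).\<close>

lemma V_V_Assoc:
  assumes [simp]: "B \<in> Ob C" "D \<in> Ob C" and f: "f \<in> Hom K A A'"
  shows "J (\<a>\<^bsub>C\<^esub> A' B D) \<cdot> V (B \<odot>\<^bsub>C\<^esub> D) f = V D (V B f) \<cdot> J (\<a>\<^bsub>C\<^esub> A B D)"
proof -
  have [simp]: "f \<in> Arr K" "Dom K f = A" "Cod K f = A'" "A \<in> Ob C" "A' \<in> Ob C"
    using f by (auto simp: Hom_def)
  have hex: "J (\<a>\<^bsub>C\<^esub> A B D) \<cdot> J (\<s>\<^bsub>C\<^esub> (B \<odot>\<^bsub>C\<^esub> D) A) \<cdot> J (\<a>\<^bsub>C\<^esub> B D A) =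
      J (\<s>\<^bsub>C\<^esub> B A \<otimes>\<^bsub>C\<^esub> \<i>\<^bsub>C\<^esub> D) \<cdot> J (\<a>\<^bsub>C\<^esub> B A D) \<cdot> J (\<i>\<^bsub>C\<^esub> B \<otimes>\<^bsub>C\<^esub> \<s>\<^bsub>C\<^esub> D A)"
    if "A \<in> Ob C" for A
    using that by (simp add: J_merge C.hexagon)
  \<comment> \<open>Precomposing with this isomorphism from \<open>B \<odot> (D \<odot> A)\<close>
    to \<open>A \<odot> (B \<odot> D)\<close> makes \<open>f\<close> act on the last factor; it is
    cancelled at the end.\<close>
  let ?p = "J (\<s>\<^bsub>C\<^esub> (B \<odot>\<^bsub>C\<^esub> D) A \<cdot>\<^bsub>C\<^esub> \<a>\<^bsub>C\<^esub> B D A)"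
  have "J (\<a>\<^bsub>C\<^esub> A' B D) \<cdot> V (B \<odot>\<^bsub>C\<^esub> D) f \<cdot> ?p =
      J (\<a>\<^bsub>C\<^esub> A' B D) \<cdot> V (B \<odot>\<^bsub>C\<^esub> D) f \<cdot> J (\<s>\<^bsub>C\<^esub> (B \<odot>\<^bsub>C\<^esub> D) A) \<cdot> J (\<a>\<^bsub>C\<^esub> B D A)"
    by (simp add: J_merge)
  also have "\<dots> = J (\<a>\<^bsub>C\<^esub> A' B D) \<cdot> J (\<s>\<^bsub>C\<^esub> (B \<odot>\<^bsub>C\<^esub> D) A') \<cdot> W (B \<odot>\<^bsub>C\<^esub> D) f \<cdot> J (\<a>\<^bsub>C\<^esub> B D A)"
    using K.Comp_extend[OF V_Sym[OF _ f, of "B \<odot>\<^bsub>C\<^esub> D"], of "J (\<a>\<^bsub>C\<^esub> B D A)"] by simp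
  also have "\<dots> = (J (\<a>\<^bsub>C\<^esub> A' B D) \<cdot> J (\<s>\<^bsub>C\<^esub> (B \<odot>\<^bsub>C\<^esub> D) A') \<cdot> J (\<a>\<^bsub>C\<^esub> B D A')) \<cdot> W B (W D f)"
    using W_Assoc[OF _ _ f, of B D] by simp
  also have "\<dots> = J (\<s>\<^bsub>C\<^esub> B A' \<otimes>\<^bsub>C\<^esub> \<i>\<^bsub>C\<^esub> D) \<cdot> J (\<a>\<^bsub>C\<^esub> B A' D) \<cdot> W B (J (\<s>\<^bsub>C\<^esub> D A') \<cdot> W D f)"
    by (subst hex) (simp_all add: W_Comp_Arr W_J_Arr)
  also have "\<dots> = J (\<s>\<^bsub>C\<^esub> B A' \<otimes>\<^bsub>C\<^esub> \<i>\<^bsub>C\<^esub> D) \<cdot> J (\<a>\<^bsub>C\<^esub> B A' D) \<cdot> W B (V D f) \<cdot> J (\<i>\<^bsub>C\<^esub> B \<otimes>\<^bsub>C\<^esub> \<s>\<^bsub>C\<^esub> D A)"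
    by (simp add: W_Comp_Arr W_J_Arr flip: V_Sym[OF _ f])
  also have "\<dots> = J (\<s>\<^bsub>C\<^esub> B A' \<otimes>\<^bsub>C\<^esub> \<i>\<^bsub>C\<^esub> D) \<cdot> V D (W B f) \<cdot> J (\<a>\<^bsub>C\<^esub> B A D) \<cdot> J (\<i>\<^bsub>C\<^esub> B \<otimes>\<^bsub>C\<^esub> \<s>\<^bsub>C\<^esub> D A)"
    using K.Comp_extend[OF W_V_Assoc[OF _ _ f, of B D], of "J (\<i>\<^bsub>C\<^esub> B \<otimes>\<^bsub>C\<^esub> \<s>\<^bsub>C\<^esub> D A)"] by simp
  also have "\<dots> = V D (J (\<s>\<^bsub>C\<^esub> B A') \<cdot> W B f) \<cdot> J (\<a>\<^bsub>C\<^esub> B A D) \<cdot> J (\<i>\<^bsub>C\<^esub> B \<otimes>\<^bsub>C\<^esub> \<s>\<^bsub>C\<^esub> D A)"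
    by (simp add: V_Comp V_J)
  also have "\<dots> = V D (V B f) \<cdot> J (\<s>\<^bsub>C\<^esub> B A \<otimes>\<^bsub>C\<^esub> \<i>\<^bsub>C\<^esub> D) \<cdot> J (\<a>\<^bsub>C\<^esub> B A D) \<cdot> J (\<i>\<^bsub>C\<^esub> B \<otimes>\<^bsub>C\<^esub> \<s>\<^bsub>C\<^esub> D A)"
    by (simp add: V_Comp V_J flip: V_Sym[OF _ f])
  also have "\<dots> = (V D (V B f) \<cdot> J (\<a>\<^bsub>C\<^esub> A B D)) \<cdot> ?p"
    by (simp add: J_merge flip: C.hexagon)
  finally have "(J (\<a>\<^bsub>C\<^esub> A' B D) \<cdot> V (B \<odot>\<^bsub>C\<^esub> D) f) \<cdot> ?p = (V D (V B f) \<cdot> J (\<a>\<^bsub>C\<^esub> A B D)) \<cdot> ?p"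
    by simp
  then show ?thesis
    by (rule K.iso_cancel_right[OF is_iso_J[OF C.is_iso_Comp[OF C.Assoc_iso C.Sym_iso]], rotated -5])
      auto
qed

text \<open>Bifunctoriality is functoriality of both whiskerings plus \<open>V_W\<close>. Naturality
  of the associator splits into its three variables. The pentagon and the triangle are images under
  \<open>J\<close>.\<close>

theorem monoidal: "monoidal_category K"
proof
  fix f A B g A' B'
  assume "f \<in> Hom K A B" "g \<in> Hom K A' B'"
  then show "f \<otimes> g \<in> Hom K (A \<odot> A') (B \<odot> B')"
    by (auto simp: Hom_def TensorArr_eq_Arr)
next
  fix f A B g D f' A' B' g' D'
  assume f: "f \<in> Hom K A B" and g: "g \<in> Hom K B D"
    and f': "f' \<in> Hom K A' B'" and g': "g' \<in> Hom K B' D'"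
  have "(g \<cdot> f) \<otimes> (g' \<cdot> f') = V D' g \<cdot> V D' f \<cdot> W A g' \<cdot> W A f'"
    using f g f' g' by (auto simp: Hom_def TensorArr_eq_Arr V_Comp W_Comp_Arr)
  also have "\<dots> = V D' g \<cdot> W B g' \<cdot> V B' f \<cdot> W A f'"
    using f g f' g' K.Comp_extend[OF V_W[OF f g'], of "W A f'"] by (auto simp: Hom_def)
  also have "\<dots> = (g \<otimes> g') \<cdot> (f \<otimes> f')"
    using f g f' g' by (auto simp: Hom_def TensorArr_eq_Arr)
  finally show "(g \<cdot> f) \<otimes> (g' \<cdot> f') = (g \<otimes> g') \<cdot> (f \<otimes> f')" .
next
  fix f A A' g B B' h D D'
  assume f: "f \<in> Hom K A A'" and g: "g \<in> Hom K B B'" and h: "h \<in> Hom K D D'"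
  have types [simp]: "f \<in> Arr K" "Dom K f = A" "Cod K f = A'" "A \<in> Ob C" "A' \<in> Ob C"
    "g \<in> Arr K" "Dom K g = B" "Cod K g = B'" "B \<in> Ob C" "B' \<in> Ob C"
    "h \<in> Arr K" "Dom K h = D" "Cod K h = D'" "D \<in> Ob C" "D' \<in> Ob C"
    using f g h by (auto simp: Hom_def)
  have "\<a> A' B' D' \<cdot> (f \<otimes> (g \<otimes> h)) =
      J (\<a>\<^bsub>C\<^esub> A' B' D') \<cdot> V (B' \<odot>\<^bsub>C\<^esub> D') f \<cdot> W A (V D' g) \<cdot> W A (W B h)"
    by (simp add: TensorArr_eq_Arr Assoc_eq W_Comp_Arr)
  also have "\<dots> = V D' (V B' f) \<cdot> J (\<a>\<^bsub>C\<^esub> A B' D') \<cdot> W A (V D' g) \<cdot> W A (W B h)"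
    using K.Comp_extend[OF V_V_Assoc[OF _ _ f, of B' D'], of "W A (V D' g) \<cdot> W A (W B h)"] by simp
  also have "\<dots> = V D' (V B' f) \<cdot> V D' (W A g) \<cdot> J (\<a>\<^bsub>C\<^esub> A B D') \<cdot> W A (W B h)"
    using K.Comp_extend[OF W_V_Assoc[OF _ _ g, of A D'], of "W A (W B h)"] by simp
  also have "\<dots> = V D' (V B' f) \<cdot> V D' (W A g) \<cdot> W (A \<odot>\<^bsub>C\<^esub> B) h \<cdot> J (\<a>\<^bsub>C\<^esub> A B D)"
    using W_Assoc[OF _ _ h, of A B] by simp
  also have "\<dots> = ((f \<otimes> g) \<otimes> h) \<cdot> \<a> A B D"
    by (simp add: TensorArr_eq_Arr Assoc_eq V_Comp)
  finally show "\<a> A' B' D' \<cdot> (f \<otimes> (g \<otimes> h)) = ((f \<otimes> g) \<otimes> h) \<cdot> \<a> A B D" .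
next
  fix f A B
  assume f: "f \<in> Hom K A B"
  then show "\<l> B \<cdot> (\<i> \<I> \<otimes> f) = f \<cdot> \<l> A"
    using W_LUnit[OF f] by (auto simp: Hom_def TensorArr_eq_Arr LUnit_eq V_Id)
  \<comment> \<open>The right unitor is the left unitor after a symmetry, and the symmetry turns
    \<open>V\<close> into \<open>W\<close>, so the left unit law suffices.\<close>
  have "J (\<r>\<^bsub>C\<^esub> B) \<cdot> V \<I> f = J (\<l>\<^bsub>C\<^esub> B) \<cdot> J (\<s>\<^bsub>C\<^esub> B \<I>) \<cdot> V \<I> f"
    using f by (auto simp: Hom_def C.RUnit_eq_LUnit_Sym J_merge_extend)
  also have "\<dots> = J (\<l>\<^bsub>C\<^esub> B) \<cdot> W \<I> f \<cdot> J (\<s>\<^bsub>C\<^esub> A \<I>)"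
    using Sym_V[OF _ f, of \<I>] by simp
  also have "\<dots> = f \<cdot> J (\<l>\<^bsub>C\<^esub> A) \<cdot> J (\<s>\<^bsub>C\<^esub> A \<I>)"
    using f K.Comp_extend[OF W_LUnit[OF f], of "J (\<s>\<^bsub>C\<^esub> A \<I>)"] by (auto simp: Hom_def)
  also have "\<dots> = f \<cdot> J (\<r>\<^bsub>C\<^esub> A)"
    using f by (auto simp: Hom_def C.RUnit_eq_LUnit_Sym J_merge)
  finally show "\<r> B \<cdot> (f \<otimes> \<i> \<I>) = f \<cdot> \<r> A"
    using f by (auto simp: Hom_def TensorArr_eq_Arr RUnit_eq W_Id)
next
  fix A B D E
  assume "A \<in> Ob K" "B \<in> Ob K" "D \<in> Ob K" "E \<in> Ob K"
  then show "\<a> (A \<odot> B) D E \<cdot> \<a> A B (D \<odot> E) =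
      (\<a> A B D \<otimes> \<i> E) \<cdot> \<a> A (B \<odot> D) E \<cdot> (\<i> A \<otimes> \<a> B D E)"
    \<comment> \<open>Reading the identities of \<open>K\<close> as images under \<open>J\<close>
      makes every factor such an image, so both sides merge into \<open>J\<close> of a side of the
      pentagon in \<open>C\<close>.\<close>
    by (simp add: Assoc_eq TensorArr_J J_merge C.pentagon flip: J_Id)
qed (auto simp: Assoc_eq LUnit_eq RUnit_eq TensorArr_J J_merge C.triangle Hom_def
    C.Assoc_iso C.LUnit_iso C.RUnit_iso is_iso_J simp flip: J_Id)

text \<open>Passing the symmetry through \<open>f \<otimes> g\<close> exchanges left and right
  whiskering, which yields the two whiskerings in the wrong order; \<open>V_W\<close> restores the
  order that defines \<open>g \<otimes> f\<close>.\<close>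

theorem symmetric_monoidal: "symmetric_monoidal_category K"
proof -
  interpret monoidal_category K
    by (rule monoidal)
  show ?thesis
  proof
    fix f A A' g B B'
    assume f: "f \<in> Hom K A A'" and g: "g \<in> Hom K B B'"
    have types [simp]: "f \<in> Arr K" "Dom K f = A" "Cod K f = A'" "A \<in> Ob C" "A' \<in> Ob C"
      "g \<in> Arr K" "Dom K g = B" "Cod K g = B'" "B \<in> Ob C" "B' \<in> Ob C"
      using f g by (auto simp: Hom_def)
    have "\<s> A' B' \<cdot> (f \<otimes> g) = J (\<s>\<^bsub>C\<^esub> A' B') \<cdot> V B' f \<cdot> W A g"
      by (simp add: TensorArr_eq_Arr Sym_eq)
    also have "\<dots> = W B' f \<cdot> J (\<s>\<^bsub>C\<^esub> A B') \<cdot> W A g"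
      using K.Comp_extend[OF Sym_V[OF _ f, of B'], of "W A g"] by simp
    also have "\<dots> = W B' f \<cdot> V A g \<cdot> J (\<s>\<^bsub>C\<^esub> A B)"
      using V_Sym[OF _ g, of A] by simp
    also have "\<dots> = V A' g \<cdot> W B f \<cdot> J (\<s>\<^bsub>C\<^esub> A B)"
      using K.Comp_extend[OF V_W[OF g f], of "J (\<s>\<^bsub>C\<^esub> A B)"]
        K.Comp_assoc_Arr[of "J (\<s>\<^bsub>C\<^esub> A B)" "V A g" "W B' f"]
      by simp
    also have "\<dots> = (g \<otimes> f) \<cdot> \<s> A B"
      by (simp add: TensorArr_eq_Arr Sym_eq)
    finally show "\<s> A' B' \<cdot> (f \<otimes> g) = (g \<otimes> f) \<cdot> \<s> A B" .
  next
    fix A B D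
    assume "A \<in> Ob K" "B \<in> Ob K" "D \<in> Ob K"
    then show "\<a> D A B \<cdot> \<s> (A \<odot> B) D \<cdot> \<a> A B D =
        (\<s> A D \<otimes> \<i> B) \<cdot> \<a> A D B \<cdot> (\<i> A \<otimes> \<s> B D)"
      by (simp add: Assoc_eq Sym_eq TensorArr_J J_merge C.hexagon flip: J_Id)
  qed (auto simp: Sym_eq J_merge C.Sym_Sym Hom_def simp flip: J_Id)
qed

text \<open>Taking daggers exchanges the two sides of the interchange law \<open>V_W\<close>.\<close>

theorem symmetric_monoidal_dagger:
  assumes "symmetric_monoidal_dagger_category C" "dagger_category K"
    and J_Dagger: "\<And>u. u \<in> Arr C \<Longrightarrow> (J u)\<dagger> = J (u\<dagger>\<^bsub>C\<^esub>)"
    and W_Dagger: "\<And>A g. A \<in> Ob C \<Longrightarrow> g \<in> Arr K \<Longrightarrow> (W A g)\<dagger> = W A (g\<dagger>)"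
  shows "symmetric_monoidal_dagger_category K"
proof -
  interpret C: symmetric_monoidal_dagger_category C
    by fact
  interpret K: dagger_category K
    by fact
  interpret symmetric_monoidal_category K
    by (rule symmetric_monoidal)
  have [simp]: "g\<dagger> \<in> Arr K" "Dom K (g\<dagger>) = Cod K g" "Cod K (g\<dagger>) = Dom K g" if "g \<in> Arr K" for g
    using K.Dagger_Hom[OF Hom_self[OF that]] by (auto simp: Hom_def)
  have Dagger_Comp: "(g \<cdot> f)\<dagger> = f\<dagger> \<cdot> g\<dagger>" if "f \<in> Arr K" "g \<in> Arr K" "Dom K g = Cod K f" for f g
    using K.Dagger_Comp[of f "Dom K f" "Cod K f" g "Cod K g"] that by (simp add: Hom_def)
  have J_unitary: "unitary K (J u)" if "unitary C u" for u
    using that by (auto simp: unitary_def inverse_arrows_def J_Dagger J_merge J_Id Hom_def)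
  \<comment> \<open>The dagger of the symmetry and the opposite symmetry are both its inverse. Hence
    the conjugation that defines \<open>V\<close> is preserved by the dagger.\<close>
  have Sym_Dagger: "(J (\<s>\<^bsub>C\<^esub> A B))\<dagger> = J (\<s>\<^bsub>C\<^esub> B A)" if [simp]: "A \<in> Ob C" "B \<in> Ob C" for A B
  proof -
    have "unitary C (\<s>\<^bsub>C\<^esub> A B)"
      by (simp add: C.Sym_unitary)
    then have "\<s>\<^bsub>C\<^esub> A B \<cdot>\<^bsub>C\<^esub> (\<s>\<^bsub>C\<^esub> A B)\<dagger>\<^bsub>C\<^esub> = \<s>\<^bsub>C\<^esub> A B \<cdot>\<^bsub>C\<^esub> \<s>\<^bsub>C\<^esub> B A"
      and "(\<s>\<^bsub>C\<^esub> A B)\<dagger>\<^bsub>C\<^esub> \<in> Hom C (B \<odot>\<^bsub>C\<^esub> A) (A \<odot>\<^bsub>C\<^esub> B)"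
      by (auto simp: unitary_def inverse_arrows_def C.Sym_Sym)
    note eq = this
    have "(\<s>\<^bsub>C\<^esub> A B)\<dagger>\<^bsub>C\<^esub> = \<s>\<^bsub>C\<^esub> B A"
      by (rule C.iso_cancel_left[OF C.Sym_iso[OF that] eq(1)]) (use eq(2) in \<open>auto simp: Hom_def\<close>)
    then show ?thesis
      by (simp add: J_Dagger)
  qed
  have V_Dagger: "(V B f)\<dagger> = V B (f\<dagger>)" if "B \<in> Ob C" "f \<in> Arr K" for B f
    using that by (simp add: V_eq_Arr Dagger_Comp W_Dagger Sym_Dagger)
  show ?thesis
  proof
    fix f g
    assume [simp]: "f \<in> Arr K" "g \<in> Arr K"
    have "(f \<otimes> g)\<dagger> = W (Dom K f) (g\<dagger>) \<cdot> V (Cod K g) (f\<dagger>)"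
      by (simp add: TensorArr_eq_Arr Dagger_Comp V_Dagger W_Dagger)
    also have "\<dots> = f\<dagger> \<otimes> g\<dagger>"
      using V_W[OF Hom_self Hom_self, of "f\<dagger>" "g\<dagger>"] by (simp add: TensorArr_eq_Arr)
    finally show "(f \<otimes> g)\<dagger> = f\<dagger> \<otimes> g\<dagger>" .
  qed (simp_all add: Assoc_eq LUnit_eq RUnit_eq Sym_eq J_unitary
      C.Assoc_unitary C.LUnit_unitary C.RUnit_unitary C.Sym_unitary)
qed

end

section \<open>Monads, Frobenius monads and strength\<close>

context monad
begin

lemma TOb_simp [simp]: "A \<in> Ob C \<Longrightarrow> TOb T A \<in> Ob C"
  by (rule TOb_Ob)

lemma TArr_simps [simp]:
  assumes "f \<in> Arr C"
  shows "TArr T f \<in> Arr C" "Dom C (TArr T f) = TOb T (Dom C f)"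
    "Cod C (TArr T f) = TOb T (Cod C f)"
  using TArr_Hom[of f "Dom C f" "Cod C f"] assms by (auto simp: Hom_def)

lemma TArr_Id_simp [simp]: "A \<in> Ob C \<Longrightarrow> TArr T (\<i> A) = \<i> (TOb T A)"
  by (rule TArr_Id)

lemma TArr_Comp_simp [simp]:
  assumes "f \<in> Arr C" "g \<in> Arr C" "Dom C g = Cod C f"
  shows "TArr T (g \<cdot> f) = TArr T g \<cdot> TArr T f"
  using TArr_Comp[of f "Dom C f" "Cod C f" g "Cod C g"] assms by (auto simp: Hom_def)

lemma mult_simps [simp]:
  assumes "A \<in> Ob C"
  shows "mult T A \<in> Arr C" "Dom C (mult T A) = TOb T (TOb T A)" "Cod C (mult T A) = TOb T A"
  using mult_Hom[OF assms] by (auto simp: Hom_def)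

lemma unit_simps [simp]:
  assumes "A \<in> Ob C"
  shows "unit T A \<in> Arr C" "Dom C (unit T A) = A" "Cod C (unit T A) = TOb T A"
  using unit_Hom[OF assms] by (auto simp: Hom_def)

lemma mult_natural_Arr:
  "f \<in> Arr C \<Longrightarrow> mult T (Cod C f) \<cdot> TArr T (TArr T f) = TArr T f \<cdot> mult T (Dom C f)"
  by (rule mult_natural) (simp add: Hom_def)

lemma unit_natural_Arr: "f \<in> Arr C \<Longrightarrow> unit T (Cod C f) \<cdot> f = TArr T f \<cdot> unit T (Dom C f)"
  by (rule unit_natural) (simp add: Hom_def)

lemma mult_unit_left_extend:
  "A \<in> Ob C \<Longrightarrow> x \<in> Arr C \<Longrightarrow> Cod C x = TOb T A \<Longrightarrow> mult T A \<cdot> unit T (TOb T A) \<cdot> x = x"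
  using Comp_extend[OF mult_unit_left[of A], of x] by simp

lemma mult_unit_right_extend:
  "A \<in> Ob C \<Longrightarrow> x \<in> Arr C \<Longrightarrow> Cod C x = TOb T A \<Longrightarrow> mult T A \<cdot> TArr T (unit T A) \<cdot> x = x"
  using Comp_extend[OF mult_unit_right[of A], of x] by simp

end

section \<open>Calculation with daggers\<close>

context dagger_category
begin

lemma Dagger_simps [simp]:
  assumes "f \<in> Arr C"
  shows "f\<dagger> \<in> Arr C" "Dom C (f\<dagger>) = Cod C f" "Cod C (f\<dagger>) = Dom C f" "(f\<dagger>)\<dagger> = f"
  using Dagger_Hom[of f "Dom C f" "Cod C f"] Dagger_Dagger[of f] assms by (auto simp: Hom_def)

lemma Dagger_Comp_simp [simp]:
  assumes "f \<in> Arr C" "g \<in> Arr C" "Dom C g = Cod C f"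
  shows "(g \<cdot> f)\<dagger> = f\<dagger> \<cdot> g\<dagger>"
  using Dagger_Comp[of f "Dom C f" "Cod C f" g "Cod C g"] assms by (simp add: Hom_def)

lemma Dagger_Id_simp [simp]: "A \<in> Ob C \<Longrightarrow> (\<i> A)\<dagger> = \<i> A"
  by (rule Dagger_Id)

end

section \<open>The dagger of a Kleisli arrow\<close>

context frobenius_monad
begin

lemma Dagger_TArr [simp]: "f \<in> Arr C \<Longrightarrow> (TArr T f)\<dagger> = TArr T (f\<dagger>)"
  by (simp add: TArr_Dagger)

text \<open>The dagger of a monad law: since \<open>T\<close> commutes with daggers, \<mu>\<dagger>
  and \<eta>\<dagger> form a comonad on \<open>T\<close>. The next two lemmas arise in the same
  way.\<close>

lemma comult_natural:
  assumes "f \<in> Arr C"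
  shows "(mult T (Cod C f))\<dagger> \<cdot> TArr T f = TArr T (TArr T f) \<cdot> (mult T (Dom C f))\<dagger>"
  using arg_cong[OF mult_natural_Arr[of "f\<dagger>"], of "Dagger C"] assms by simp

lemma comult_coassoc:
  assumes "A \<in> Ob C"
  shows "TArr T ((mult T A)\<dagger>) \<cdot> (mult T A)\<dagger> = (mult T (TOb T A))\<dagger> \<cdot> (mult T A)\<dagger>"
  using arg_cong[OF mult_assoc, of A "Dagger C"] assms by simp

lemma counit_comult:
  assumes "A \<in> Ob C"
  shows "TArr T ((unit T A)\<dagger>) \<cdot> (mult T A)\<dagger> = \<i> (TOb T A)"
  using arg_cong[OF mult_unit_right, of A "Dagger C"] assms by simp

text \<open>The transpose of \<open>f\<dagger>\<close> under the adjunction of \<open>T\<close> with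
  itself whose unit is \<mu>\<dagger> \<circ> \<eta> and whose counit is \<eta>\<dagger> \<circ>
  \<mu>. The object \<open>B\<close> is a separate argument because \<open>TOb T B\<close> need not
  determine it.\<close>

definition kleisli_dagger :: "'m \<Rightarrow> 'o \<Rightarrow> 'm" where
  "kleisli_dagger f B = TArr T (f\<dagger>) \<cdot> (mult T B)\<dagger> \<cdot> unit T B"

text \<open>Makes the canonical functor preserve daggers: the counit law removes the
  comultiplication, and naturality of \<eta> does the rest.\<close>

lemma kleisli_dagger_unit_Comp:
  assumes "f \<in> Hom C A B"
  shows "kleisli_dagger (unit T B \<cdot> f) B = unit T A \<cdot> f\<dagger>"
proof -
  have [simp]: "f \<in> Arr C" "Dom C f = A" "Cod C f = B" "A \<in> Ob C" "B \<in> Ob C"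
    using assms by (auto simp: Hom_def)
  have "kleisli_dagger (unit T B \<cdot> f) B = TArr T (f\<dagger>) \<cdot> unit T B"
    using Comp_extend[OF counit_comult[of B], of "unit T B"] by (simp add: kleisli_dagger_def)
  then show ?thesis
    using unit_natural_Arr[of "f\<dagger>"] by simp
qed

text \<open>In essence a snake identity of the self-adjunction of \<open>T\<close>. The Frobenius
  law trades T(\<mu>) after \<mu>\<dagger> for \<mu> after T(\<mu>\<dagger>); then \<eta> can be
  moved left until the unit law and the counit law apply.\<close>

lemma kleisli_dagger_kleisli_dagger:
  assumes "f \<in> Hom C A (TOb T B)" "B \<in> Ob C"
  shows "kleisli_dagger (kleisli_dagger f B) A = f"
proof -
  have [simp]: "f \<in> Arr C" "Dom C f = A" "Cod C f = TOb T B" "A \<in> Ob C" "B \<in> Ob C"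
    using assms by (auto simp: Hom_def)
  let ?e = "TArr T ((unit T B)\<dagger>)"
  have "kleisli_dagger (kleisli_dagger f B) A =
      ?e \<cdot> TArr T (mult T B) \<cdot> TArr T (TArr T f) \<cdot> (mult T A)\<dagger> \<cdot> unit T A"
    by (simp add: kleisli_dagger_def)
  also have "\<dots> = ?e \<cdot> TArr T (mult T B) \<cdot> (mult T (TOb T B))\<dagger> \<cdot> TArr T f \<cdot> unit T A"
    using Comp_extend[OF comult_natural[of f], of "unit T A"] by simp
  also have "\<dots> = ?e \<cdot> mult T (TOb T B) \<cdot> TArr T ((mult T B)\<dagger>) \<cdot> TArr T f \<cdot> unit T A"
    using Comp_extend[OF frobenius_law[of B], of "TArr T f \<cdot> unit T A"] by simp
  also have "\<dots> = ?e \<cdot> mult T (TOb T B) \<cdot> unit T (TOb T (TOb T B)) \<cdot> (mult T B)\<dagger> \<cdot> f"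
    using unit_natural_Arr[of "(mult T B)\<dagger> \<cdot> f"] by simp
  also have "\<dots> = f"
    using Comp_extend[OF counit_comult[of B], of f] by (simp add: mult_unit_left_extend)
  finally show ?thesis .
qed

text \<open>Naturality pulls the parts from \<open>f\<close> and \<open>g\<close> to the front. By
  the Frobenius law and the right unit law, the remaining \<mu> \<circ> T(\<mu>\<dagger>) \<circ>
  T(\<eta>) at \<open>TOb T D\<close> is just \<mu>\<dagger>, and coassociativity finishes.\<close>

lemma kleisli_dagger_Comp:
  assumes "f \<in> Hom C A (TOb T B)" "g \<in> Hom C B (TOb T D)" "D \<in> Ob C" "B \<in> Ob C"
  shows "kleisli_dagger (mult T D \<cdot> TArr T g \<cdot> f) D = mult T A \<cdot> TArr T (kleisli_dagger f B) \<cdot> kleisli_dagger g D"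
proof -
  have [simp]: "f \<in> Arr C" "Dom C f = A" "Cod C f = TOb T B" "A \<in> Ob C" "B \<in> Ob C"
    "g \<in> Arr C" "Dom C g = B" "Cod C g = TOb T D" "D \<in> Ob C"
    using assms by (auto simp: Hom_def)
  let ?f = "TArr T (f\<dagger>)" and ?g = "TArr T (g\<dagger>)"
  let ?x = "(mult T D)\<dagger> \<cdot> unit T D"
  let ?\<eta> = "TArr T (unit T (TOb T D))"
  have "mult T A \<cdot> TArr T (kleisli_dagger f B) \<cdot> kleisli_dagger g D =
      mult T A \<cdot> TArr T ?f \<cdot> TArr T ((mult T B)\<dagger>) \<cdot> TArr T (unit T B \<cdot> g\<dagger>) \<cdot> ?x"
    by (simp add: kleisli_dagger_def)
  also have "\<dots> = ?f \<cdot> mult T (TOb T B) \<cdot> TArr T ((mult T B)\<dagger>) \<cdot> TArr T (unit T B \<cdot> g\<dagger>) \<cdot> ?x"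
    using Comp_extend[OF mult_natural_Arr[of "f\<dagger>"],
        of "TArr T ((mult T B)\<dagger>) \<cdot> TArr T (unit T B \<cdot> g\<dagger>) \<cdot> ?x"] by simp
  also have "\<dots> = ?f \<cdot> mult T (TOb T B) \<cdot> TArr T ((mult T B)\<dagger> \<cdot> ?g) \<cdot> ?\<eta> \<cdot> ?x"
    using unit_natural_Arr[of "g\<dagger>"] by simp
  also have "\<dots> = ?f \<cdot> mult T (TOb T B) \<cdot> TArr T (TArr T ?g) \<cdot>
      TArr T ((mult T (TOb T D))\<dagger>) \<cdot> ?\<eta> \<cdot> ?x"
    using comult_natural[of "g\<dagger>"] by simp
  also have "\<dots> = ?f \<cdot> TArr T ?g \<cdot> mult T (TOb T (TOb T D)) \<cdot>
      TArr T ((mult T (TOb T D))\<dagger>) \<cdot> ?\<eta> \<cdot> ?x"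
    using Comp_extend[OF mult_natural_Arr[of ?g],
        of "TArr T ((mult T (TOb T D))\<dagger>) \<cdot> ?\<eta> \<cdot> ?x"] by simp
  also have "\<dots> = ?f \<cdot> TArr T ?g \<cdot> TArr T (mult T (TOb T D)) \<cdot>
      (mult T (TOb T (TOb T D)))\<dagger> \<cdot> ?\<eta> \<cdot> ?x"
    using Comp_extend[OF frobenius_law[of "TOb T D"], of "?\<eta> \<cdot> ?x"] by simp
  also have "\<dots> = ?f \<cdot> TArr T ?g \<cdot> TArr T (mult T (TOb T D)) \<cdot>
      TArr T ?\<eta> \<cdot> (mult T (TOb T D))\<dagger> \<cdot> ?x"
    using Comp_extend[OF comult_natural[of "unit T (TOb T D)"], of ?x] by simp
  \<comment> \<open>The multiplication and the unit are gathered under one \<open>TArr T\<close>, so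
    that the right unit law can act inside it.\<close>
  also have "\<dots> = ?f \<cdot> TArr T ?g \<cdot> TArr T (mult T (TOb T D) \<cdot> ?\<eta>) \<cdot> (mult T (TOb T D))\<dagger> \<cdot> ?x"
    by simp
  also have "\<dots> = ?f \<cdot> TArr T ?g \<cdot> (mult T (TOb T D))\<dagger> \<cdot> (mult T D)\<dagger> \<cdot> unit T D"
    by (simp add: mult_unit_right del: TArr_Comp_simp)
  also have "\<dots> = ?f \<cdot> TArr T ?g \<cdot> TArr T ((mult T D)\<dagger>) \<cdot> (mult T D)\<dagger> \<cdot> unit T D"
    using Comp_extend[OF comult_coassoc[of D], of "unit T D"] by simp
  finally show ?thesis
    by (simp add: kleisli_dagger_def)
qed

end

section \<open>Typing and naturality of the strength\<close>

context strong_monad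
begin

lemma strength_simps [simp]:
  assumes "A \<in> Ob C" "B \<in> Ob C"
  shows "strength T A B \<in> Arr C" "Dom C (strength T A B) = A \<odot> TOb T B"
    "Cod C (strength T A B) = TOb T (A \<odot> B)"
  using strength_Hom[OF assms] by (auto simp: Hom_def)

lemma strength_natural_Arr:
  assumes "f \<in> Arr C" "g \<in> Arr C"
  shows "strength T (Cod C f) (Cod C g) \<cdot> (f \<otimes> TArr T g) =
    TArr T (f \<otimes> g) \<cdot> strength T (Dom C f) (Dom C g)"
  by (rule strength_natural) (use assms in \<open>auto simp: Hom_def\<close>)

end

section \<open>The Kleisli category of a commutative strong Frobenius monad\<close>

lemma kleisli_simps [simp]:
  "Ob (kleisli C T) = Ob C"
  "Arr (kleisli C T) = {(A, f, B). A \<in> Ob C \<and> B \<in> Ob C \<and> f \<in> Hom C A (TOb T B)}"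
  "Dom (kleisli C T) (A, f, B) = A"
  "Cod (kleisli C T) (A, f, B) = B"
  "Id (kleisli C T) A = (A, unit T A, A)"
  "Comp (kleisli C T) (B, g, D) (A, f, B') = (A, mult T D \<cdot>\<^bsub>C\<^esub> TArr T g \<cdot>\<^bsub>C\<^esub> f, D)"
  "Unit (kleisli C T) = Unit C"
  "TensorOb (kleisli C T) A B = TensorOb C A B"
  "TensorArr (kleisli C T) (A, f, B) (A', g, B') =
    (TensorOb C A A', dst C T B B' \<cdot>\<^bsub>C\<^esub> (f \<otimes>\<^bsub>C\<^esub> g), TensorOb C B B')"
  "Assoc (kleisli C T) A B D = kleisli_embed C T (Assoc C A B D)"
  "LUnit (kleisli C T) A = kleisli_embed C T (LUnit C A)"
  "RUnit (kleisli C T) A = kleisli_embed C T (RUnit C A)"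
  "Sym (kleisli C T) A B = kleisli_embed C T (Sym C A B)"
  "Dagger (kleisli C T) (A, f, B) =
    (B, TArr T (Dagger C f) \<cdot>\<^bsub>C\<^esub> Dagger C (mult T B) \<cdot>\<^bsub>C\<^esub> unit T B, A)"
  by (simp_all add: kleisli_def)

lemma Hom_kleisli: "Hom (kleisli C T) A B =
    {(A, f, B) | f. A \<in> Ob C \<and> B \<in> Ob C \<and> f \<in> Arr C \<and> Dom C f = A \<and> Cod C f = TOb T B}"
  by (auto simp: Hom_def)

definition kleisli_lwhisker ::
    "('o, 'm, 'z) cat_data_scheme \<Rightarrow> ('o, 'm, 'y) strong_monad_data_scheme \<Rightarrow>
     'o \<Rightarrow> 'o \<times> 'm \<times> 'o \<Rightarrow> 'o \<times> 'm \<times> 'o" where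
  "kleisli_lwhisker C T A = (\<lambda>(B, g, B').
     (A \<odot>\<^bsub>C\<^esub> B, strength T A B' \<cdot>\<^bsub>C\<^esub> (\<i>\<^bsub>C\<^esub> A \<otimes>\<^bsub>C\<^esub> g), A \<odot>\<^bsub>C\<^esub> B'))"

definition kleisli_rwhisker ::
    "('o, 'm, 'z) cat_data_scheme \<Rightarrow> ('o, 'm, 'y) strong_monad_data_scheme \<Rightarrow>
     'o \<Rightarrow> 'o \<times> 'm \<times> 'o \<Rightarrow> 'o \<times> 'm \<times> 'o" where
  "kleisli_rwhisker C T B = (\<lambda>(A, f, A').
     (A \<odot>\<^bsub>C\<^esub> B, strength' C T A' B \<cdot>\<^bsub>C\<^esub> (f \<otimes>\<^bsub>C\<^esub> \<i>\<^bsub>C\<^esub> B), A' \<odot>\<^bsub>C\<^esub> B))"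

section \<open>Laws of Kleisli composition\<close>

context monad
begin

text \<open>The right identity law of Kleisli composition: naturality moves \<eta> past
  \<open>f\<close>, next to \<mu>.\<close>

lemma unit_mult_Comp:
  assumes "f \<in> Arr C" "Cod C f = TOb T B" "B \<in> Ob C"
  shows "mult T B \<cdot> TArr T f \<cdot> unit T (Dom C f) = f"
  using assms unit_natural_Arr[of f] by (metis mult_unit_left_extend)

lemma kleisli_Comp_assoc:
  assumes "f \<in> Arr C" "g \<in> Arr C" "h \<in> Arr C" "D \<in> Ob C" "E \<in> Ob C"
    and "Cod C f = TOb T (Dom C g)" "Cod C g = TOb T D" "Dom C h = D" "Cod C h = TOb T E"
  shows "mult T E \<cdot> TArr T (mult T E \<cdot> TArr T h \<cdot> g) \<cdot> f =
    mult T E \<cdot> TArr T h \<cdot> mult T D \<cdot> TArr T g \<cdot> f"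
  using assms Comp_extend[OF mult_natural_Arr[of h], of "TArr T g \<cdot> f"]
    Comp_extend[OF mult_assoc[of E], of "TArr T (TArr T h) \<cdot> TArr T g \<cdot> f"]
  by simp

end

section \<open>Whiskering, tensor and dagger of Kleisli arrows\<close>

context strong_frobenius_monad
begin

lemma strength'_simps [simp]:
  assumes "A \<in> Ob C" "B \<in> Ob C"
  shows "strength' C T A B \<in> Arr C" "Dom C (strength' C T A B) = TOb T A \<odot> B"
    "Cod C (strength' C T A B) = TOb T (A \<odot> B)"
  using assms by (auto simp: strength'_def)

lemma strength'_natural:
  assumes "f \<in> Arr C" "g \<in> Arr C"
  shows "strength' C T (Cod C f) (Cod C g) \<cdot> (TArr T f \<otimes> g) =
    TArr T (f \<otimes> g) \<cdot> strength' C T (Dom C f) (Dom C g)"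
proof -
  have "strength' C T (Cod C f) (Cod C g) \<cdot> (TArr T f \<otimes> g) =
      TArr T (\<s> (Cod C g) (Cod C f)) \<cdot> strength T (Cod C g) (Cod C f) \<cdot> (g \<otimes> TArr T f) \<cdot>
        \<s> (TOb T (Dom C f)) (Dom C g)"
    using assms Sym_natural_Arr[of "TArr T f" g] by (simp add: strength'_def)
  also have "\<dots> = TArr T (\<s> (Cod C g) (Cod C f) \<cdot> (g \<otimes> f)) \<cdot> strength T (Dom C g) (Dom C f) \<cdot>
        \<s> (TOb T (Dom C f)) (Dom C g)"
    using assms
      Comp_extend[OF strength_natural_Arr[of g f], of "\<s> (TOb T (Dom C f)) (Dom C g)"] by simp
  also have "\<dots> = TArr T (f \<otimes> g) \<cdot> strength' C T (Dom C f) (Dom C g)"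
    unfolding Sym_natural_Arr[OF assms(2,1)] using assms by (simp add: strength'_def)
  finally show ?thesis .
qed

text \<open>The right-hand side is the Kleisli composite that whiskers \<open>g\<close> on the left
  first and then \<open>f\<close> on the right.\<close>

lemma dst_TensorArr:
  assumes "f \<in> Arr C" "g \<in> Arr C" "Cod C f = TOb T A" "Cod C g = TOb T B" "A \<in> Ob C" "B \<in> Ob C"
  shows "dst C T A B \<cdot> (f \<otimes> g) =
    mult T (A \<odot> B) \<cdot> TArr T (strength' C T A B \<cdot> (f \<otimes> \<i> B)) \<cdot>
      strength T (Dom C f) B \<cdot> (\<i> (Dom C f) \<otimes> g)"
proof -
  \<comment> \<open>The identity of \<open>TOb T B\<close> is written as
    \<open>TArr T (\<i> B)\<close>, which lets naturality of the strength carry \<open>f\<close>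
    across.\<close>
  have "dst C T A B \<cdot> (f \<otimes> g) = mult T (A \<odot> B) \<cdot> TArr T (strength' C T A B) \<cdot>
      (strength T (TOb T A) B \<cdot> (f \<otimes> TArr T (\<i> B))) \<cdot> (\<i> (Dom C f) \<otimes> g)"
    using assms by (simp add: dst_def interchange)
  also have "strength T (TOb T A) B \<cdot> (f \<otimes> TArr T (\<i> B)) = TArr T (f \<otimes> \<i> B) \<cdot> strength T (Dom C f) B"
    using assms strength_natural_Arr[of f "\<i> B"] by simp
  finally show ?thesis
    using assms by simp
qed

text \<open>The counterpart with the opposite order, first \<open>f\<close> and then
  \<open>g\<close>; commutativity identifies the two.\<close>

lemma dst'_TensorArr:
  assumes "f \<in> Arr C" "g \<in> Arr C" "Cod C f = TOb T A" "Cod C g = TOb T B" "A \<in> Ob C" "B \<in> Ob C"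
  shows "dst' C T A B \<cdot> (f \<otimes> g) =
    mult T (A \<odot> B) \<cdot> TArr T (strength T A B \<cdot> (\<i> A \<otimes> g)) \<cdot>
      strength' C T A (Dom C g) \<cdot> (f \<otimes> \<i> (Dom C g))"
proof -
  have "dst' C T A B \<cdot> (f \<otimes> g) = mult T (A \<odot> B) \<cdot> TArr T (strength T A B) \<cdot>
      (strength' C T A (TOb T B) \<cdot> (TArr T (\<i> A) \<otimes> g)) \<cdot> (f \<otimes> \<i> (Dom C g))"
    using assms by (simp add: dst'_def interchange)
  also have "strength' C T A (TOb T B) \<cdot> (TArr T (\<i> A) \<otimes> g) =
      TArr T (\<i> A \<otimes> g) \<cdot> strength' C T A (Dom C g)"
    using assms strength'_natural[of "\<i> A" g] by simp
  finally show ?thesis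
    using assms by simp
qed

text \<open>Since the strength is unitary, it also respects the comultiplication.\<close>

lemma strength_comult:
  assumes [simp]: "A \<in> Ob C" "B \<in> Ob C"
  shows "strength T A (TOb T B) \<cdot> (\<i> A \<otimes> (mult T B)\<dagger>) =
    TArr T ((strength T A B)\<dagger>) \<cdot> (mult T (A \<odot> B))\<dagger> \<cdot> strength T A B"
proof -
  have u: "(strength T A B)\<dagger> \<cdot> strength T A B = \<i> (A \<odot> TOb T B)"
      "strength T A B \<cdot> (strength T A B)\<dagger> = \<i> (TOb T (A \<odot> B))"
    if "A \<in> Ob C" "B \<in> Ob C" for A B
    using strength_unitary[OF that] that by (auto simp: unitary_def inverse_arrows_def)
  have "(\<i> A \<otimes> (mult T B)\<dagger>) \<cdot> (strength T A B)\<dagger> =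
      (strength T A (TOb T B))\<dagger> \<cdot> TArr T ((strength T A B)\<dagger>) \<cdot> (mult T (A \<odot> B))\<dagger>"
    using arg_cong[OF strength_mult[of A B], of "Dagger C"] by (simp add: Dagger_TensorArr)
  \<comment> \<open>The preceding equation is the dagger of \<open>strength_mult\<close>. Composing
    it with a strength on each side cancels one daggered strength on either side, by
    unitarity.\<close>
  then have "strength T A (TOb T B) \<cdot> ((\<i> A \<otimes> (mult T B)\<dagger>) \<cdot> (strength T A B)\<dagger>) \<cdot> strength T A B =
      strength T A (TOb T B) \<cdot> ((strength T A (TOb T B))\<dagger> \<cdot> TArr T ((strength T A B)\<dagger>) \<cdot>
        (mult T (A \<odot> B))\<dagger>) \<cdot> strength T A B"
    by simp
  then show ?thesis
    by (simp add: u Comp_extend[OF u(2)])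
qed

text \<open>The strength moves in turn past T(g\<dagger>) by naturality, past \<mu>\<dagger> by
  \<open>strength_comult\<close> and past \<eta> by \<open>strength_unit\<close>.\<close>

lemma kleisli_dagger_lwhisker:
  assumes "g \<in> Arr C" "Cod C g = TOb T B" "A \<in> Ob C" "B \<in> Ob C"
  shows "kleisli_dagger (strength T A B \<cdot> (\<i> A \<otimes> g)) (A \<odot> B) =
    strength T A (Dom C g) \<cdot> (\<i> A \<otimes> kleisli_dagger g B)"
proof -
  have "strength T A (Dom C g) \<cdot> (\<i> A \<otimes> kleisli_dagger g B) =
      strength T A (Dom C g) \<cdot> (\<i> A \<otimes> TArr T (g\<dagger>)) \<cdot> (\<i> A \<otimes> (mult T B)\<dagger>) \<cdot> (\<i> A \<otimes> unit T B)"
    using assms by (simp add: interchange kleisli_dagger_def)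
  also have "\<dots> = TArr T (\<i> A \<otimes> g\<dagger>) \<cdot> strength T A (TOb T B) \<cdot> (\<i> A \<otimes> (mult T B)\<dagger>) \<cdot> (\<i> A \<otimes> unit T B)"
    using assms Comp_extend[OF strength_natural_Arr[of "\<i> A" "g\<dagger>"],
        of "(\<i> A \<otimes> (mult T B)\<dagger>) \<cdot> (\<i> A \<otimes> unit T B)"] by simp
  also have "\<dots> = TArr T (\<i> A \<otimes> g\<dagger>) \<cdot> TArr T ((strength T A B)\<dagger>) \<cdot> (mult T (A \<odot> B))\<dagger> \<cdot>
      strength T A B \<cdot> (\<i> A \<otimes> unit T B)"
    using assms Comp_extend[OF strength_comult[of A B], of "\<i> A \<otimes> unit T B"] by simp
  also have "\<dots> = kleisli_dagger (strength T A B \<cdot> (\<i> A \<otimes> g)) (A \<odot> B)"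
    using assms by (simp add: strength_unit kleisli_dagger_def Dagger_TensorArr)
  finally show ?thesis ..
qed

lemma kleisli_dagger_category: "dagger_category (kleisli C T)"
proof
  fix f g h A B D E
  assume "f \<in> Hom (kleisli C T) A B" "g \<in> Hom (kleisli C T) B D" "h \<in> Hom (kleisli C T) D E"
  then show "(h \<cdot>\<^bsub>kleisli C T\<^esub> g) \<cdot>\<^bsub>kleisli C T\<^esub> f = h \<cdot>\<^bsub>kleisli C T\<^esub> g \<cdot>\<^bsub>kleisli C T\<^esub> f"
    using kleisli_Comp_assoc by (auto simp: Hom_kleisli simp del: TArr_Comp_simp)
next
  fix f g A B D
  assume "f \<in> Hom (kleisli C T) A B" "g \<in> Hom (kleisli C T) B D"
  then show "(g \<cdot>\<^bsub>kleisli C T\<^esub> f)\<dagger>\<^bsub>kleisli C T\<^esub> = f\<dagger>\<^bsub>kleisli C T\<^esub> \<cdot>\<^bsub>kleisli C T\<^esub> g\<dagger>\<^bsub>kleisli C T\<^esub>"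
    \<comment> \<open>The dagger is folded into \<open>kleisli_dagger\<close>, and the rules that
      distribute \<open>T\<close> and the dagger over composites are switched off so that the folded
      form keeps matching.\<close>
    using kleisli_dagger_Comp
    by (auto simp: Hom_kleisli Hom_def kleisli_dagger_def[symmetric]
        simp del: TArr_Comp_simp Dagger_Comp_simp)
next
  fix f
  assume "f \<in> Arr (kleisli C T)"
  then show "(f\<dagger>\<^bsub>kleisli C T\<^esub>)\<dagger>\<^bsub>kleisli C T\<^esub> = f"
    using kleisli_dagger_kleisli_dagger
    by (auto simp: kleisli_dagger_def[symmetric] simp del: TArr_Comp_simp Dagger_Comp_simp)
next
  fix A
  assume "A \<in> Ob (kleisli C T)"
  then show "(\<i>\<^bsub>kleisli C T\<^esub> A)\<dagger>\<^bsub>kleisli C T\<^esub> = \<i>\<^bsub>kleisli C T\<^esub> A"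
    using Comp_extend[OF counit_comult[of A], of "unit T A"] by simp
qed (auto simp: Hom_kleisli Hom_def mult_unit_right_extend unit_mult_Comp)

end

section \<open>Assembly of the Kleisli category\<close>

context commutative_strong_frobenius_monad
begin

text \<open>Laws of the strength supply the whiskering laws: \<open>strength_mult\<close> with
  naturality gives \<open>W_Comp\<close>, \<open>strength_unit\<close> gives \<open>W_J\<close>,
  \<open>strength_Assoc\<close> gives \<open>W_Assoc\<close> and \<open>strength_LUnit\<close> gives
  \<open>W_LUnit\<close>. Commutativity gives \<open>V_W\<close>.\<close>

lemma kleisli_whiskered_extension:
  "whiskered_extension C (kleisli C T) (kleisli_embed C T)
    (kleisli_lwhisker C T) (kleisli_rwhisker C T)"
proof -
  interpret K: dagger_category "kleisli C T"
    by (rule kleisli_dagger_category)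
  let ?K = "kleisli C T"
  let ?J = "kleisli_embed C T"
  let ?W = "kleisli_lwhisker C T"
  let ?V = "kleisli_rwhisker C T"
  \<comment> \<open>Composing with an arrow from the image of the canonical functor needs no
    multiplication: after a Kleisli arrow it acts as \<open>TArr T u\<close>, before one as
    \<open>u\<close>.\<close>
  have J_Comp: "Comp ?K (?J u) (A, f, B) = (A, TArr T u \<cdot> f, Cod C u)"
    if "u \<in> Arr C" "Dom C u = B" "f \<in> Arr C" "Cod C f = TOb T B" for A B u f
    using that by (simp add: kleisli_embed_def mult_unit_right_extend)
  have Comp_J: "Comp ?K (A, f, B) (?J u) = (Dom C u, f \<cdot> u, B)"
    if "u \<in> Arr C" "Cod C u = A" "f \<in> Arr C" "Dom C f = A" "Cod C f = TOb T B" "B \<in> Ob C"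
    for A B u f
  proof -
    have "(mult T B \<cdot> TArr T f \<cdot> unit T A) \<cdot> u = f \<cdot> u"
      using that unit_mult_Comp[of f B] by simp
    then show ?thesis
      using that by (auto simp: kleisli_embed_def)
  qed
  have W: "?W A (B, g, B') = (A \<odot> B, strength T A B' \<cdot> (\<i> A \<otimes> g), A \<odot> B')" for A B g B'
    by (simp add: kleisli_lwhisker_def)
  have V: "?V B (A, f, A') = (A \<odot> B, strength' C T A' B \<cdot> (f \<otimes> \<i> B), A' \<odot> B)" for A B f A'
    by (simp add: kleisli_rwhisker_def)
  show ?thesis
  proof
    fix k l A A' B B'
    assume "k \<in> Hom ?K A A'" "l \<in> Hom ?K B B'"
    then obtain f g where kl: "k = (A, f, A')" "l = (B, g, B')" and
      types [simp]: "f \<in> Arr C" "Dom C f = A" "Cod C f = TOb T A'" "A \<in> Ob C" "A' \<in> Ob C"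
        "g \<in> Arr C" "Dom C g = B" "Cod C g = TOb T B'" "B \<in> Ob C" "B' \<in> Ob C"
      by (auto simp: Hom_kleisli)
    show "TensorArr ?K k l = Comp ?K (?V B' k) (?W A l)"
      using dst_TensorArr[of f g A' B'] by (simp add: kl V W)
    \<comment> \<open>Both orders of whiskering unfold to a double strength applied to
      \<open>f \<otimes> g\<close>, one to \<open>dst\<close> and the other to
      \<open>dst'\<close>.\<close>
    show "Comp ?K (?V B' k) (?W A l) = Comp ?K (?W A' l) (?V B k)"
      using dst_TensorArr[of f g A' B'] dst'_TensorArr[of f g A' B'] commutative[of A' B']
      by (simp add: kl V W)
  next
    fix u A B
    assume "u \<in> Hom C A B"
    then show "?J u \<in> Hom ?K A B"
      by (auto simp: Hom_def kleisli_embed_def)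
  next
    fix A
    assume "A \<in> Ob C"
    then show "?J (\<i> A) = Id ?K A"
      by (simp add: kleisli_embed_def)
  next
    fix u v A B D
    assume "u \<in> Hom C A B" "v \<in> Hom C B D"
    then show "?J (v \<cdot> u) = Comp ?K (?J v) (?J u)"
      using Comp_J[of u "Dom C v" "unit T D \<cdot> v" D] by (auto simp: Hom_def kleisli_embed_def)
  next
    fix A k B B'
    assume "A \<in> Ob C" "k \<in> Hom ?K B B'"
    then show "?W A k \<in> Hom ?K (TensorOb ?K A B) (TensorOb ?K A B')"
      by (auto simp: Hom_kleisli W)
  next
    fix A k l B B' B''
    assume [simp]: "A \<in> Ob C" and "k \<in> Hom ?K B B'" "l \<in> Hom ?K B' B''"
    then obtain g h where kl: "k = (B, g, B')" "l = (B', h, B'')" and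
      types [simp]: "g \<in> Arr C" "Dom C g = B" "Cod C g = TOb T B'" "B \<in> Ob C" "B' \<in> Ob C"
        "h \<in> Arr C" "Dom C h = B'" "Cod C h = TOb T B''" "B'' \<in> Ob C"
      by (auto simp: Hom_kleisli)
    have "strength T A B'' \<cdot> (\<i> A \<otimes> (mult T B'' \<cdot> TArr T h \<cdot> g)) =
        strength T A B'' \<cdot> (\<i> A \<otimes> mult T B'') \<cdot> (\<i> A \<otimes> TArr T h) \<cdot> (\<i> A \<otimes> g)"
      by (simp add: interchange)
    also have "\<dots> = mult T (A \<odot> B'') \<cdot> TArr T (strength T A B'') \<cdot>
        strength T A (TOb T B'') \<cdot> (\<i> A \<otimes> TArr T h) \<cdot> (\<i> A \<otimes> g)"
      using Comp_extend[OF strength_mult[of A B''], of "(\<i> A \<otimes> TArr T h) \<cdot> (\<i> A \<otimes> g)"] by simp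
    also have "\<dots> = mult T (A \<odot> B'') \<cdot> TArr T (strength T A B'') \<cdot>
        TArr T (\<i> A \<otimes> h) \<cdot> strength T A B' \<cdot> (\<i> A \<otimes> g)"
      using Comp_extend[OF strength_natural_Arr[of "\<i> A" h], of "\<i> A \<otimes> g"] by simp
    finally show "?W A (Comp ?K l k) = Comp ?K (?W A l) (?W A k)"
      by (simp add: kl W)
  next
    fix A u B B'
    assume "A \<in> Ob C" "u \<in> Hom C B B'"
    then have [simp]: "A \<in> Ob C" "u \<in> Arr C" "Dom C u = B" "Cod C u = B'" "B \<in> Ob C" "B' \<in> Ob C"
      by (auto simp: Hom_def)
    have "strength T A B' \<cdot> (\<i> A \<otimes> (unit T B' \<cdot> u)) = strength T A B' \<cdot> (\<i> A \<otimes> unit T B') \<cdot> (\<i> A \<otimes> u)"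
      by (simp add: interchange)
    also have "\<dots> = unit T (A \<odot> B') \<cdot> (\<i> A \<otimes> u)"
      using Comp_extend[OF strength_unit[of A B'], of "\<i> A \<otimes> u"] by simp
    finally show "?W A (?J u) = ?J (\<i> A \<otimes> u)"
      by (simp add: kleisli_embed_def W)
  next
    fix u k A A' B B'
    assume "u \<in> Hom C A A'" "k \<in> Hom ?K B B'"
    then obtain g where k: "k = (B, g, B')" and
      types [simp]: "u \<in> Arr C" "Dom C u = A" "Cod C u = A'" "A \<in> Ob C" "A' \<in> Ob C"
        "g \<in> Arr C" "Dom C g = B" "Cod C g = TOb T B'" "B \<in> Ob C" "B' \<in> Ob C"
      by (auto simp: Hom_kleisli Hom_def)
    have "TArr T (u \<otimes> \<i> B') \<cdot> strength T A B' \<cdot> (\<i> A \<otimes> g) =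
        strength T A' B' \<cdot> (u \<otimes> \<i> (TOb T B')) \<cdot> (\<i> A \<otimes> g)"
      using Comp_extend[OF strength_natural_Arr[of u "\<i> B'"], of "\<i> A \<otimes> g"] by simp
    also have "\<dots> = strength T A' B' \<cdot> (\<i> A' \<otimes> g) \<cdot> (u \<otimes> \<i> B)"
      by (simp add: interchange)
    finally show "Comp ?K (?J (u \<otimes> \<i> B')) (?W A k) = Comp ?K (?W A' k) (?J (u \<otimes> \<i> B))"
      by (simp add: k W J_Comp Comp_J)
  next
    fix A B k D D'
    assume [simp]: "A \<in> Ob C" "B \<in> Ob C" and "k \<in> Hom ?K D D'"
    then obtain h where k: "k = (D, h, D')" and
      types [simp]: "h \<in> Arr C" "Dom C h = D" "Cod C h = TOb T D'" "D \<in> Ob C" "D' \<in> Ob C"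
      by (auto simp: Hom_kleisli Hom_def)
    have "TArr T (\<a> A B D') \<cdot> strength T A (B \<odot> D') \<cdot> (\<i> A \<otimes> (strength T B D' \<cdot> (\<i> B \<otimes> h))) =
        (TArr T (\<a> A B D') \<cdot> strength T A (B \<odot> D') \<cdot> (\<i> A \<otimes> strength T B D')) \<cdot> (\<i> A \<otimes> \<i> B \<otimes> h)"
      by (simp add: interchange)
    also have "\<dots> = strength T (A \<odot> B) D' \<cdot> \<a> A B (TOb T D') \<cdot> (\<i> A \<otimes> \<i> B \<otimes> h)"
      by (simp flip: strength_Assoc)
    also have "\<dots> = strength T (A \<odot> B) D' \<cdot> (\<i> (A \<odot> B) \<otimes> h) \<cdot> \<a> A B D"
      using Assoc_natural_Arr[of "\<i> A" "\<i> B" h] by simp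
    finally show "Comp ?K (?J (\<a> A B D')) (?W A (?W B k)) =
        Comp ?K (?W (TensorOb ?K A B) k) (?J (\<a> A B D))"
      by (simp add: k W J_Comp Comp_J)
  next
    fix k B B'
    assume "k \<in> Hom ?K B B'"
    then obtain g where k: "k = (B, g, B')" and
      types [simp]: "g \<in> Arr C" "Dom C g = B" "Cod C g = TOb T B'" "B \<in> Ob C" "B' \<in> Ob C"
      by (auto simp: Hom_kleisli Hom_def)
    have "TArr T (\<l> B') \<cdot> strength T \<I> B' \<cdot> (\<i> \<I> \<otimes> g) = g \<cdot> \<l> B"
      using Comp_extend[OF strength_LUnit[of B'], of "\<i> \<I> \<otimes> g"] LUnit_natural_Arr[of g] by simp
    then show "Comp ?K (?J (\<l> B')) (?W (Unit ?K) k) = Comp ?K k (?J (\<l> B))"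
      by (simp add: k W J_Comp Comp_J)
  next
    fix k A A' B
    assume [simp]: "B \<in> Ob C" and "k \<in> Hom ?K A A'"
    then obtain f where k: "k = (A, f, A')" and
      types [simp]: "f \<in> Arr C" "Dom C f = A" "Cod C f = TOb T A'" "A \<in> Ob C" "A' \<in> Ob C"
      by (auto simp: Hom_kleisli Hom_def)
    have "strength' C T A' B \<cdot> (f \<otimes> \<i> B) =
        TArr T (\<s> B A') \<cdot> strength T B A' \<cdot> (\<i> B \<otimes> f) \<cdot> \<s> A B"
      using Sym_natural_Arr[of f "\<i> B"] by (simp add: strength'_def)
    then show "?V B k = Comp ?K (?J (\<s> B A')) (Comp ?K (?W B k) (?J (\<s> A B)))"
      by (simp add: k V W J_Comp Comp_J)
  qed simp_all
qed

text \<open>Two checks on the dagger remain: on the image of the canonical functor and on left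
  whiskering. The latter rests on unitarity of the strength.\<close>

theorem kleisli_symmetric_monoidal_dagger: "symmetric_monoidal_dagger_category (kleisli C T)"
proof (rule whiskered_extension.symmetric_monoidal_dagger[OF kleisli_whiskered_extension])
  fix u
  assume "u \<in> Arr C"
  then show "(kleisli_embed C T u)\<dagger>\<^bsub>kleisli C T\<^esub> = kleisli_embed C T (u\<dagger>)"
    using kleisli_dagger_unit_Comp[of u "Dom C u" "Cod C u"]
    by (simp add: kleisli_embed_def Hom_def kleisli_dagger_def)
next
  fix A k
  assume "A \<in> Ob C" "k \<in> Arr (kleisli C T)"
  then show "(kleisli_lwhisker C T A k)\<dagger>\<^bsub>kleisli C T\<^esub> = kleisli_lwhisker C T A (k\<dagger>\<^bsub>kleisli C T\<^esub>)"
    using kleisli_dagger_lwhisker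
    by (auto simp: kleisli_lwhisker_def Hom_def kleisli_dagger_def)
qed (rule symmetric_monoidal_dagger_category_axioms kleisli_dagger_category)+

end

theorem theorem5p4:
  fixes C :: "('o, 'm) cat_data"
    and T :: "('o, 'm) strong_monad_data"
  assumes "symmetric_monoidal_dagger_category C"
    and "commutative_strong_frobenius_monad C T"
  shows "symmetric_monoidal_dagger_category (kleisli C T)"
  using assms(2) by (rule commutative_strong_frobenius_monad.kleisli_symmetric_monoidal_dagger)

end
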